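(* Let $A\subset\mathbb{R}^d$ be a closed Lipschitz domain. Then $A$ is locally WDC if and only if $A$ is a closed DC domain.
   Context: A real function on an open convex set of a finite-dimensional space is DC if it is a difference of two convex functions. For locally Lipschitz $f$, $\partial f(x)$ is the Clarke subgradient. A number $c$ is a weakly regular value of $f$ if whenever $x_i\to x$, $f(x_i)>c=f(x)$ and $u_i\in\partial f(x_i)$, then $\liminf_i|u_i|>0$. A set $A\subset\mathbb{R}^d$ is WDC if there is a DC function $f:\mathbb{R}^d\to[0,\infty)$ with $A=f^{-1}\{0\}$ and $0$ a weakly regular value of $f$; $A$ is locally WDC if for every $a\in A$ there is a WDC set agreeing with $A$ on an open neighbourhood of $a$. A closed set $A\subset\mathbb{R}^d$ is a closed Lipschitz domain (resp. closed DC domain) if for each $a\in\partial A$ there exist $r>0$, a $(d-1)$-dimensional linear subspace $W$, a unit vector $v\in W^\perp$ and a Lipschitz (resp. DC) function $\varphi:W\to\mathbb{R}$ such that $A\cap B(a,r)=\{w+tv:w\in W,\ t\le\varphi(w)\}\cap B(a,r)$. *)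

theory Defs
  imports "HOL-Analysis.Analysis"
begin

definition DC_on :: "'a::real_vector set \<Rightarrow> ('a \<Rightarrow> real) \<Rightarrow> bool" where
  "DC_on S f \<longleftrightarrow> (\<exists>g h. convex_on S g \<and> convex_on S h \<and> (\<forall>x\<in>S. f x = g x - h x))"

definition clarke_dir :: "('a::euclidean_space \<Rightarrow> real) \<Rightarrow> 'a \<Rightarrow> 'a \<Rightarrow> ereal" where
  "clarke_dir f x v = Limsup (nhds x \<times>\<^sub>F at_right (0::real))
      (\<lambda>(y, t). ereal ((f (y + t *\<^sub>R v) - f y) / t))"

definition clarke_subdiff :: "('a::euclidean_space \<Rightarrow> real) \<Rightarrow> 'a \<Rightarrow> 'a set" where
  "clarke_subdiff f x = {u. \<forall>v. ereal (u \<bullet> v) \<le> clarke_dir f x v}"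

definition weakly_regular_value :: "('a::euclidean_space \<Rightarrow> real) \<Rightarrow> real \<Rightarrow> bool" where
  "weakly_regular_value f c \<longleftrightarrow>
     (\<forall>xs x us. xs \<longlonglongrightarrow> x \<longrightarrow> (\<forall>i. f (xs i) > c) \<longrightarrow> f x = c \<longrightarrow>
        (\<forall>i. us i \<in> clarke_subdiff f (xs i)) \<longrightarrow>
        Liminf sequentially (\<lambda>i. ereal (norm (us i))) > 0)"

definition WDC_set :: "'a::euclidean_space set \<Rightarrow> bool" where
  "WDC_set A \<longleftrightarrow> (\<exists>f. DC_on UNIV f \<and> (\<forall>x. f x \<ge> 0) \<and> A = f -` {0}
                        \<and> weakly_regular_value f 0)"

definition locally_WDC :: "'a::euclidean_space set \<Rightarrow> bool" where
  "locally_WDC A \<longleftrightarrow> (\<forall>a\<in>A. \<exists>B U. WDC_set B \<and> open U \<and> a \<in> U \<and> A \<inter> U = B \<inter> U)"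

definition closed_graph_domain ::
  "('a::euclidean_space set \<Rightarrow> ('a \<Rightarrow> real) \<Rightarrow> bool) \<Rightarrow> 'a set \<Rightarrow> bool" where
  "closed_graph_domain P A \<longleftrightarrow> closed A \<and>
     (\<forall>a\<in>frontier A. \<exists>r>0. \<exists>W v \<phi>. subspace W \<and> dim W = DIM('a) - 1 \<and>
        norm v = 1 \<and> (\<forall>w\<in>W. v \<bullet> w = 0) \<and> P W \<phi> \<and>
        A \<inter> ball a r = {w + t *\<^sub>R v | w t. w \<in> W \<and> t \<le> \<phi> w} \<inter> ball a r)"

definition closed_lipschitz_domain :: "'a::euclidean_space set \<Rightarrow> bool" where
  "closed_lipschitz_domain = closed_graph_domain (\<lambda>W \<phi>. \<exists>C. C-lipschitz_on W \<phi>)"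

definition closed_DC_domain :: "'a::euclidean_space set \<Rightarrow> bool" where
  "closed_DC_domain = closed_graph_domain DC_on"

end

theory Submission
  imports Defs
begin

text \<open>
  If the boundary is the graph of a DC function, then the positive part of the vertical distance to
  the graph is a DC function with Clarke subgradients of norm at least 1 off the set.

  Conversely let the set be locally the subgraph of a Lipschitz function in direction \<open>v\<close>, and
  the zero set of a DC function \<open>f = g - h \<ge> 0\<close> with weakly regular value 0. Minimising \<open>f\<close> plus a
  small multiple of the distance shows that \<open>f\<close> is bounded below by a multiple of the distance to
  the set, so that \<open>f\<close> grows at rate at least some \<open>c > 0\<close> along \<open>v\<close> from each boundary point
  \<open>p\<close>. Hence \<open>g\<close> and \<open>h\<close> have subgradients \<open>u\<close> and \<open>b\<close> at \<open>p\<close> whose slopes along \<open>v\<close> differ by at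
  least \<open>c\<close>. Let \<open>k\<close> be the common value of \<open>g\<close> and \<open>h\<close> on the graph and \<open>\<theta>\<close> its height. For every
  slope \<open>\<alpha>\<close> between those of \<open>b\<close> and \<open>u\<close>, the function \<open>k - \<alpha> \<theta>\<close> has an affine support at \<open>p\<close>.
  Two neighbouring points of a fixed finite grid of slopes always lie in this range. So \<open>\<theta>\<close> is a
  continuous selection of finitely many DC functions, the scaled differences of the affine envelopes
  of consecutive \<open>k - \<alpha> \<theta>\<close>, and such selections are DC.
\<close>

section \<open>Convex functions\<close>

lemma convex_on_max:
  assumes "convex_on S f" "convex_on S g"
  shows "convex_on S (\<lambda>x. max (f x) (g x))"
proof
  show "convex S" using assms convex_on_imp_convex by blast
  fix t x y assume t: "(0::real) < t" "t < 1" "x \<in> S" "y \<in> S"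
  have "f ((1 - t) *\<^sub>R x + t *\<^sub>R y) \<le> (1 - t) * f x + t * f y"
       "g ((1 - t) *\<^sub>R x + t *\<^sub>R y) \<le> (1 - t) * g x + t * g y"
    using convex_onD[OF assms(1), of t x y] convex_onD[OF assms(2), of t x y] t by auto
  moreover have "(1 - t) * f x + t * f y \<le> (1 - t) * max (f x) (g x) + t * max (f y) (g y)"
       "(1 - t) * g x + t * g y \<le> (1 - t) * max (f x) (g x) + t * max (f y) (g y)"
    using t by (auto intro!: add_mono mult_left_mono)
  ultimately show "max (f ((1 - t) *\<^sub>R x + t *\<^sub>R y)) (g ((1 - t) *\<^sub>R x + t *\<^sub>R y))
      \<le> (1 - t) * max (f x) (g x) + t * max (f y) (g y)"
    by linarith
qed

lemma convex_on_UNIV_sum: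
  fixes f :: "'i \<Rightarrow> 'a::real_vector \<Rightarrow> real"
  assumes "\<And>i. i \<in> I \<Longrightarrow> convex_on UNIV (f i)"
  shows "convex_on UNIV (\<lambda>x. \<Sum>i\<in>I. f i x)"
  using assms by (induction I rule: infinite_finite_induct) (auto simp: convex_on_const intro!: convex_on_add)

section \<open>Subgradients: prescribed slope and local bounds\<close>

text \<open>A Hahn-Banach argument: the strict epigraph \<open>S\<close> of \<open>g\<close> is
  convex and misses the ray \<open>R\<close> of slope \<open>m\<close> issuing from the graph point
  over \<open>p\<close>. A separating hyperplane is non-vertical and touches the graph at
  \<open>p\<close>, so it is the graph of an affine minorant whose slope along \<open>v\<close> is
  at least \<open>m\<close>.\<close>

lemma ex_subgradient_slope_ge:
  fixes g :: "'a::euclidean_space \<Rightarrow> real"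
  assumes g: "convex_on UNIV g" and ray: "\<And>t. t \<ge> 0 \<Longrightarrow> g p + m * t \<le> g (p + t *\<^sub>R v)"
  obtains u where "\<And>y. g y \<ge> g p + u \<bullet> (y - p)" "u \<bullet> v \<ge> m"
proof -
  define S where "S = {z. g (fst z) < snd z}"
  define R where "R = {(p + t *\<^sub>R v, g p + m * t) | t. t \<ge> 0}"
  have "convex S"
  proof (rule convexI)
    fix x y :: "'a \<times> real" and a b :: real
    assume *: "x \<in> S" "y \<in> S" "a \<ge> 0" "b \<ge> 0" "a + b = 1"
    have "g (a *\<^sub>R fst x + b *\<^sub>R fst y) \<le> a * g (fst x) + b * g (fst y)"
      using g * by (auto simp: convex_on_def)
    also have "\<dots> < a * snd x + b * snd y"
    proof (cases "a = 0")
      case False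
      then have "a * g (fst x) < a * snd x" "b * g (fst y) \<le> b * snd y"
        using * by (auto simp: S_def intro!: mult_strict_left_mono mult_left_mono)
      then show ?thesis by linarith
    qed (use * in \<open>auto simp: S_def\<close>)
    finally show "a *\<^sub>R x + b *\<^sub>R y \<in> S" by (simp add: S_def)
  qed
  moreover have "convex R"
  proof (rule convexI)
    fix x y :: "'a \<times> real" and a b :: real
    assume *: "x \<in> R" "y \<in> R" "a \<ge> 0" "b \<ge> 0" "a + b = 1"
    then obtain s t where st: "x = (p + s *\<^sub>R v, g p + m * s)" "y = (p + t *\<^sub>R v, g p + m * t)"
      "s \<ge> 0" "t \<ge> 0" by (auto simp: R_def)
    have b: "b = 1 - a" using * by simp
    have "a *\<^sub>R x + b *\<^sub>R y = (p + (a * s + b * t) *\<^sub>R v, g p + m * (a * s + b * t))"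
      unfolding st b by (auto simp: algebra_simps)
    then show "a *\<^sub>R x + b *\<^sub>R y \<in> R" using st * by (auto simp: R_def)
  qed
  moreover have "(p, g p + 1) \<in> S" "(p + 0 *\<^sub>R v, g p + m * 0) \<in> R"
    by (simp add: S_def) (auto simp: R_def simp del: mult_zero_right scaleR_zero_left)
  moreover have "S \<inter> R = {}" using ray by (fastforce simp: S_def R_def)
  ultimately obtain a b where ab: "a \<noteq> 0" "\<forall>x\<in>S. a \<bullet> x \<le> b" "\<forall>x\<in>R. a \<bullet> x \<ge> b"
    using separating_hyperplane_sets[of S R] by blast
  obtain w \<sigma> where a: "a = (w, \<sigma>)" by (cases a)
  have S: "w \<bullet> x + \<sigma> * s \<le> b" if "g x < s" for x s
    using ab(2) that by (auto simp: a S_def)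
  have R: "w \<bullet> p + t * (w \<bullet> v) + \<sigma> * (g p + m * t) \<ge> b" if "t \<ge> 0" for t
    using ab(3) that by (force simp: a R_def algebra_simps)
  have "\<sigma> < 0"
  proof (rule ccontr)
    assume "\<not> \<sigma> < 0"
    moreover have "\<sigma> \<le> 0"
    proof (rule ccontr)
      assume "\<not> \<sigma> \<le> 0"
      then have "\<sigma> * (g p + 1) < \<sigma> * (g p + 2)" by simp
      then show False using S[of p "g p + 2"] R[of 0] \<open>\<not> \<sigma> \<le> 0\<close>
        by (simp add: algebra_simps)
    qed
    ultimately have "\<sigma> = 0" by simp
    \<comment> \<open>A vertical hyperplane is impossible: the epigraph has points over
      \<open>p + w\<close>, and this forces \<open>w = 0\<close>.\<close>
    then have "w \<bullet> (p + w) \<le> b" "w \<bullet> p \<ge> b" using S[of "p + w" "g (p + w) + 1"] R[of 0] by auto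
    then have "w \<bullet> w \<le> 0" by (simp add: inner_add_right)
    then have "w = 0" by (metis inner_gt_zero_iff not_le)
    then show False using ab(1) a \<open>\<sigma> = 0\<close> by (simp add: zero_prod_def)
  qed
  define u where "u = w /\<^sub>R (- \<sigma>)"
  have w: "w = (-\<sigma>) *\<^sub>R u" using \<open>\<sigma> < 0\<close> by (simp add: u_def)
  have lower: "w \<bullet> x + \<sigma> * g x \<le> b" for x
  proof (rule field_le_epsilon)
    fix e :: real assume "e > 0"
    then have "w \<bullet> x + \<sigma> * (g x + e / (-\<sigma>)) \<le> b" by (intro S) (use \<open>\<sigma> < 0\<close> \<open>e > 0\<close> in \<open>simp add: divide_pos_neg\<close>)
    moreover have "\<sigma> * (g x + e / (-\<sigma>)) = \<sigma> * g x - e" using \<open>\<sigma> < 0\<close> by (simp add: right_diff_distrib)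
    ultimately show "w \<bullet> x + \<sigma> * g x \<le> b + e" by simp
  qed
  have b: "b = w \<bullet> p + \<sigma> * g p" using lower[of p] R[of 0] by simp
  show ?thesis
  proof (rule that[of u])
    fix y
    have "(-\<sigma>) * (u \<bullet> (y - p) + g p) \<le> (-\<sigma>) * g y"
      using lower[of y] unfolding b w by (simp add: algebra_simps)
    then show "g y \<ge> g p + u \<bullet> (y - p)" using \<open>\<sigma> < 0\<close> by (auto simp: mult_le_cancel_left)
    have "(-\<sigma>) * m \<le> (-\<sigma>) * (u \<bullet> v)" using R[of 1] unfolding b w by (simp add: algebra_simps)
    then show "u \<bullet> v \<ge> m" using \<open>\<sigma> < 0\<close> by (auto simp: mult_le_cancel_left)
  qed
qed

lemma ex_subgradient:
  fixes g :: "'a::euclidean_space \<Rightarrow> real"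
  assumes "convex_on UNIV g"
  obtains u where "\<And>y. g y \<ge> g p + u \<bullet> (y - p)"
  using ex_subgradient_slope_ge[OF assms, of p 0 0] by auto

text \<open>A unit step from \<open>p\<close> in the direction of \<open>u\<close> raises
  \<open>g\<close> by at least \<open>norm u\<close> and stays in the ball of radius
  \<open>R + 1\<close>, where \<open>g\<close> is bounded by compactness.\<close>

lemma subgradients_bounded_on_ball:
  fixes g :: "'a::euclidean_space \<Rightarrow> real"
  assumes g: "convex_on UNIV g"
  obtains L where "L > 0"
    "\<And>p u. \<lbrakk>p \<in> ball a R; \<And>y. g y \<ge> g p + u \<bullet> (y - p)\<rbrakk> \<Longrightarrow> norm u \<le> L"
proof -
  have "continuous_on (cball a (R + 1)) g"
    using convex_on_continuous[OF open_UNIV g] continuous_on_subset by blast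
  then have "bounded (g ` cball a (R + 1))"
    by (simp add: compact_continuous_image compact_imp_bounded)
  then obtain M where M: "\<And>y. y \<in> cball a (R + 1) \<Longrightarrow> \<bar>g y\<bar> \<le> M"
    unfolding bounded_iff by (metis imageI real_norm_def)
  show ?thesis
  proof (rule that[of "2 * \<bar>M\<bar> + 1"])
    fix p u assume p: "p \<in> ball a R" and u: "\<And>y. g y \<ge> g p + u \<bullet> (y - p)"
    show "norm u \<le> 2 * \<bar>M\<bar> + 1"
    proof (cases "u = 0")
      case False
      define y where "y = p + u /\<^sub>R norm u"
      have "dist p y \<le> 1" using False by (simp add: y_def dist_norm)
      then have "\<bar>g y\<bar> \<le> M" "\<bar>g p\<bar> \<le> M"
        using p dist_triangle[of a y p] by (auto intro!: M)
      moreover have "u \<bullet> (y - p) = norm u"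
        using False by (simp add: y_def dot_square_norm power2_eq_square)
      ultimately show ?thesis using u[of y] by linarith
    qed auto
  qed simp
qed

text \<open>A subgradient at \<open>x\<close>, with the uniform bound on its norm, controls
  \<open>g x - g y\<close>; exchanging the points gives the other inequality.\<close>

lemma convex_on_UNIV_lipschitz_on_ball:
  fixes g :: "'a::euclidean_space \<Rightarrow> real"
  assumes g: "convex_on UNIV g"
  obtains L where "L-lipschitz_on (ball a R) g"
proof -
  obtain L where L: "L > 0"
    "\<And>p u. \<lbrakk>p \<in> ball a R; \<And>y. g y \<ge> g p + u \<bullet> (y - p)\<rbrakk> \<Longrightarrow> norm u \<le> L"
    using subgradients_bounded_on_ball[OF g] by metis
  have le: "g x - g y \<le> L * dist x y" if "x \<in> ball a R" for x y
  proof -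
    obtain u where u: "\<And>y. g y \<ge> g x + u \<bullet> (y - x)" using ex_subgradient[OF g] by metis
    then have "norm u \<le> L" using L that by blast
    have "\<bar>u \<bullet> (y - x)\<bar> \<le> norm u * norm (y - x)" by (rule Cauchy_Schwarz_ineq2)
    also have "\<dots> \<le> L * dist x y" using \<open>norm u \<le> L\<close> by (simp add: dist_norm norm_minus_commute mult_right_mono)
    finally show ?thesis using u[of y] by linarith
  qed
  have "L-lipschitz_on (ball a R) g"
  proof (rule lipschitz_onI)
    fix x y assume "x \<in> ball a R" "y \<in> ball a R"
    then show "dist (g x) (g y) \<le> L * dist x y"
      using le[of x y] le[of y x] by (simp add: dist_real_def dist_commute abs_le_iff)
  qed (use L in simp)
  then show ?thesis by (rule that)
qed

section \<open>Extending convex functions and recognising convexity locally\<close>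

text \<open>The McShane formula, an infimal convolution with \<open>K\<close> times the norm:
  \<open>P x + K * dist x y\<close> is jointly convex in \<open>x\<close> and \<open>y\<close>, so
  its infimum over \<open>x\<close> is convex in \<open>y\<close>. The Lipschitz bound says that for
  \<open>y\<close> in \<open>D\<close> the choice \<open>x = y\<close> is optimal.\<close>

lemma lipschitz_convex_extension:
  fixes P :: "'a::euclidean_space \<Rightarrow> real"
  assumes P: "convex_on D P" and lip: "K-lipschitz_on D P" and ne: "D \<noteq> {}"
  obtains Q where "convex_on UNIV Q" "\<And>x. x \<in> D \<Longrightarrow> Q x = P x"
proof -
  define Q where "Q y = (INF x\<in>D. P x + K * dist x y)" for y
  have K: "K \<ge> 0" using lip lipschitz_on_nonneg by blast
  have lip': "P x \<le> P x' + K * dist x x'" if "x \<in> D" "x' \<in> D" for x x'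
    using lipschitz_onD[OF lip that] by (auto simp: dist_real_def)
  obtain x0 where x0: "x0 \<in> D" using ne by blast
  have bdd: "bdd_below ((\<lambda>x. P x + K * dist x y) ` D)" for y
  proof (rule bdd_belowI2)
    fix x assume "x \<in> D"
    have "K * dist x0 x \<le> K * (dist x0 y + dist x y)"
      by (intro mult_left_mono dist_triangle2 K)
    then show "P x0 - K * dist x0 y \<le> P x + K * dist x y"
      using lip'[OF x0 \<open>x \<in> D\<close>] by (simp add: algebra_simps)
  qed
  have Qle: "Q y \<le> P x + K * dist x y" if "x \<in> D" for x y
    unfolding Q_def by (rule cINF_lower[OF bdd that])
  have Qapp: "\<exists>x\<in>D. P x + K * dist x y < Q y + e" if "e > 0" for y e
    using cINF_less_iff[OF ne bdd, of y "Q y + e"] that by (auto simp: Q_def)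
  have "convex_on UNIV Q"
  proof
    fix t :: real and x y :: 'a assume t: "0 < t" "t < 1"
    show "Q ((1 - t) *\<^sub>R x + t *\<^sub>R y) \<le> (1 - t) * Q x + t * Q y"
    proof (rule field_le_epsilon)
      fix e :: real assume "e > 0"
      obtain x' where x': "x' \<in> D" "P x' + K * dist x' x < Q x + e" using Qapp[OF \<open>e > 0\<close>] by blast
      obtain y' where y': "y' \<in> D" "P y' + K * dist y' y < Q y + e" using Qapp[OF \<open>e > 0\<close>] by blast
      let ?z = "(1 - t) *\<^sub>R x' + t *\<^sub>R y'"
      have "?z \<in> D" using P x'(1) y'(1) t convex_on_imp_convex convexD_alt[of D x' y' t] by fastforce
      have "?z - ((1 - t) *\<^sub>R x + t *\<^sub>R y) = (1 - t) *\<^sub>R (x' - x) + t *\<^sub>R (y' - y)"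
        by (simp add: algebra_simps)
      then have "dist ?z ((1 - t) *\<^sub>R x + t *\<^sub>R y) \<le> (1 - t) * dist x' x + t * dist y' y"
        unfolding dist_norm using norm_triangle_ineq[of "(1 - t) *\<^sub>R (x' - x)" "t *\<^sub>R (y' - y)"] t by simp
      then have "K * dist ?z ((1 - t) *\<^sub>R x + t *\<^sub>R y) \<le> K * ((1 - t) * dist x' x + t * dist y' y)"
        by (rule mult_left_mono[OF _ K])
      moreover have "P ?z \<le> (1 - t) * P x' + t * P y'"
        using convex_onD[OF P, of t x' y'] t x' y' by simp
      moreover have "(1 - t) * (P x' + K * dist x' x) \<le> (1 - t) * (Q x + e)"
        "t * (P y' + K * dist y' y) \<le> t * (Q y + e)"
        using x' y' t by (auto intro!: mult_left_mono)
      ultimately show "Q ((1 - t) *\<^sub>R x + t *\<^sub>R y) \<le> (1 - t) * Q x + t * Q y + e"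
        using Qle[OF \<open>?z \<in> D\<close>, of "(1 - t) *\<^sub>R x + t *\<^sub>R y"] by (simp add: algebra_simps)
    qed
  qed simp
  moreover have "Q x = P x" if "x \<in> D" for x
  proof (rule antisym)
    show "Q x \<le> P x" using Qle[OF that, of x] by simp
    show "P x \<le> Q x" unfolding Q_def using lip'[OF that]
      by (intro cINF_greatest ne) (simp add: dist_commute)
  qed
  ultimately show ?thesis by (rule that)
qed

text \<open>On a segment let \<open>e\<close> be \<open>u\<close> minus its chord. If
  \<open>e\<close> had a positive maximum, then at a maximiser the local affine support could not
  increase to the right. It would then keep \<open>e\<close> maximal slightly to the left, which is
  impossible at the leftmost maximiser.\<close>

lemma convex_on_if_local_affine_support:
  fixes u :: "'a::euclidean_space \<Rightarrow> real"
  assumes D: "convex D" and cont: "continuous_on D u"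
    and supp: "\<And>x. x \<in> D \<Longrightarrow> \<exists>s. \<forall>\<^sub>F y in at x within D. u y \<ge> u x + s \<bullet> (y - x)"
  shows "convex_on D u"
proof
  fix t :: real and x y :: 'a assume t: "0 < t" "t < 1" and xy: "x \<in> D" "y \<in> D"
  define c where "c \<tau> = x + \<tau> *\<^sub>R (y - x)" for \<tau>
  define e where "e \<tau> = u (c \<tau>) - (u x + \<tau> * (u y - u x))" for \<tau>
  have cD: "c \<tau> \<in> D" if "\<tau> \<in> {0..1}" for \<tau>
    using convexD_alt[OF D xy, of \<tau>] that by (simp add: c_def algebra_simps)
  have cont_e: "continuous_on {0..1} e"
    unfolding e_def by (intro continuous_intros continuous_on_compose2[OF cont])
      (auto simp: cD, auto simp: c_def intro!: continuous_intros)
  have e01: "e 0 = 0" "e 1 = 0" by (simp_all add: e_def c_def)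
  have "e t \<le> 0"
  proof (rule ccontr)
    assume "\<not> e t \<le> 0"
    obtain m where m: "m \<in> {0..1}" "\<And>\<tau>. \<tau> \<in> {0..1} \<Longrightarrow> e \<tau> \<le> e m"
      using continuous_attains_sup[OF compact_Icc _ cont_e] by auto
    have "e m > 0" using m(2)[of t] t \<open>\<not> e t \<le> 0\<close> by simp
    define Z where "Z = {\<tau> \<in> {0..1}. e \<tau> = e m}"
    have "closed Z" unfolding Z_def by (intro continuous_closed_preimage_constant cont_e closed_atLeastAtMost)
    moreover have "bounded Z" by (rule bounded_subset[of "{0..1}"]) (auto simp: Z_def)
    ultimately have "compact Z" by (simp add: compact_eq_bounded_closed)
    moreover have "Z \<noteq> {}" using m by (auto simp: Z_def)
    \<comment> \<open>The leftmost maximiser; it is interior because \<open>e\<close> vanishes at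
      both ends.\<close>
    ultimately obtain z where z: "z \<in> Z" "\<And>\<tau>. \<tau> \<in> Z \<Longrightarrow> z \<le> \<tau>"
      using continuous_attains_inf[of Z "\<lambda>x. x"] by auto
    have ez: "e z = e m" and z01: "z \<in> {0..1}" using z by (auto simp: Z_def)
    have "z \<noteq> 0" "z \<noteq> 1" using ez \<open>e m > 0\<close> e01 by auto
    then have z01': "0 < z" "z < 1" using z01 by auto
    obtain s where s: "\<forall>\<^sub>F y in at (c z) within D. u y \<ge> u (c z) + s \<bullet> (y - c z)"
      using supp[OF cD[OF z01]] by blast
    then obtain d where d: "d > 0" "\<And>y. y \<in> D \<Longrightarrow> dist y (c z) < d \<Longrightarrow> u y \<ge> u (c z) + s \<bullet> (y - c z)"
      unfolding eventually_at by (metis diff_self inner_zero_right add.right_neutral order_refl)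
    define \<sigma> where "\<sigma> = s \<bullet> (y - x) - (u y - u x)"
    have esup: "e \<tau> \<ge> e z + \<sigma> * (\<tau> - z)" if "\<tau> \<in> {0..1}" "\<bar>\<tau> - z\<bar> * norm (y - x) < d" for \<tau>
    proof -
      have diff: "c \<tau> - c z = (\<tau> - z) *\<^sub>R (y - x)" by (simp add: c_def algebra_simps)
      then have "dist (c \<tau>) (c z) < d" using that by (simp add: dist_norm)
      then have "u (c \<tau>) \<ge> u (c z) + s \<bullet> (c \<tau> - c z)" using d(2)[OF cD[OF that(1)]] by blast
      then show ?thesis unfolding diff by (simp add: e_def \<sigma>_def algebra_simps)
    qed
    \<comment> \<open>Small enough for the support inequality to hold at \<open>z + \<eta>\<close>
      and \<open>z - \<eta>\<close>, and for both to stay in the unit interval.\<close>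
    define \<eta> where "\<eta> = min (d / (2 * (norm (y - x) + 1))) (min z (1 - z))"
    have \<eta>: "\<eta> > 0" "\<eta> \<le> z" "\<eta> \<le> 1 - z"
      using d(1) z01' by (auto simp: \<eta>_def add_nonneg_pos)
    have "\<eta> * norm (y - x) < d"
    proof -
      have "\<eta> * norm (y - x) \<le> \<eta> * (norm (y - x) + 1)" using \<eta> by simp
      also have "\<dots> \<le> d / (2 * (norm (y - x) + 1)) * (norm (y - x) + 1)"
        by (intro mult_right_mono) (auto simp: \<eta>_def)
      also have "\<dots> = d / 2" by (simp add: field_simps add_nonneg_eq_0_iff)
      finally show ?thesis using d(1) by simp
    qed
    then have "e (z + \<eta>) \<ge> e z + \<sigma> * \<eta>" "e (z - \<eta>) \<ge> e z - \<sigma> * \<eta>"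
      using esup[of "z + \<eta>"] esup[of "z - \<eta>"] \<eta> z01' by auto
    moreover have "e (z + \<eta>) \<le> e m" "e (z - \<eta>) \<le> e m"
      using m(2)[of "z + \<eta>"] m(2)[of "z - \<eta>"] \<eta> z01' by auto
    ultimately have "e (z - \<eta>) = e m" using ez by linarith
    then have "z - \<eta> \<in> Z" using \<eta> z01' by (auto simp: Z_def)
    then show False using z(2) \<eta>(1) by fastforce
  qed
  then show "u ((1 - t) *\<^sub>R x + t *\<^sub>R y) \<le> (1 - t) * u x + t * u y"
    by (simp add: e_def c_def algebra_simps)
qed (rule D)

section \<open>DC functions\<close>

text \<open>Near \<open>x\<close> only the indices in \<open>J\<close> are active; whichever of them \<open>\<phi>\<close> selects, adding the
  maxima with one fixed active \<open>G j0\<close> dominates the sum of all active functions, with equality at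
  \<open>x\<close>.\<close>

lemma convex_on_selection_plus_max:
  fixes G :: "'i \<Rightarrow> 'a::euclidean_space \<Rightarrow> real"
  assumes fin: "finite I" and G: "\<And>i. i \<in> I \<Longrightarrow> convex_on UNIV (G i)"
    and D: "convex D" and cont: "continuous_on D \<phi>"
    and sel: "\<And>x. x \<in> D \<Longrightarrow> \<exists>i\<in>I. \<phi> x = G i x"
  shows "convex_on D (\<lambda>x. \<phi> x + (\<Sum>j\<in>I. \<Sum>i\<in>I. max (G i x) (G j x)))"
proof (rule convex_on_if_local_affine_support[OF D])
  have contG: "continuous_on UNIV (G i)" if "i \<in> I" for i
    using convex_on_continuous[OF open_UNIV G[OF that]] .
  then have contG': "continuous_on D (G i)" if "i \<in> I" for i
    using that continuous_on_subset by blast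
  show "continuous_on D (\<lambda>x. \<phi> x + (\<Sum>j\<in>I. \<Sum>i\<in>I. max (G i x) (G j x)))"
    by (intro continuous_intros cont contG')
  fix x assume x: "x \<in> D"
  define J where "J = {i \<in> I. G i x = \<phi> x}"
  obtain j0 where j0: "j0 \<in> I" "G j0 x = \<phi> x" using sel[OF x] by auto
  \<comment> \<open>For active \<open>i\<close> the maximum with \<open>G j0\<close> is replaced by
    \<open>G i\<close> alone; at \<open>x\<close> nothing changes because both have the value
    \<open>\<phi> x\<close>.\<close>
  define A where "A y = G j0 y + (\<Sum>i\<in>I. if i \<in> J then G i y else max (G i y) (G j0 y))" for y
  define B where "B y = (\<Sum>j\<in>I - {j0}. \<Sum>i\<in>I. max (G i y) (G j y))" for y
  have split: "(\<Sum>j\<in>I. \<Sum>i\<in>I. max (G i y) (G j y)) = (\<Sum>i\<in>I. max (G i y) (G j0 y)) + B y" for y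
    unfolding B_def by (rule sum.remove[OF fin j0(1)])
  have "convex_on UNIV (\<lambda>y. if i \<in> J then G i y else max (G i y) (G j0 y))" if "i \<in> I" for i
    using G[OF that] convex_on_max[OF G[OF that] G[OF j0(1)]] by (cases "i \<in> J") auto
  then have "convex_on UNIV A" unfolding A_def
    by (intro convex_on_add G j0 convex_on_UNIV_sum) auto
  moreover have "convex_on UNIV B" unfolding B_def
    by (intro convex_on_UNIV_sum convex_on_max G) auto
  ultimately have "convex_on UNIV (\<lambda>y. A y + B y)" by (rule convex_on_add)
  then obtain s where s: "\<And>y. A y + B y \<ge> A x + B x + s \<bullet> (y - x)"
    using ex_subgradient[of "\<lambda>y. A y + B y" x] by metis
  have "A x = \<phi> x + (\<Sum>i\<in>I. max (G i x) (G j0 x))"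
    unfolding A_def j0(2) by (intro arg_cong2[where f="(+)"] sum.cong refl) (auto simp: J_def)
  moreover have "\<forall>\<^sub>F y in at x within D. A y \<le> \<phi> y + (\<Sum>i\<in>I. max (G i y) (G j0 y))"
  proof -
    \<comment> \<open>By continuity an inactive function stays different from \<open>\<phi>\<close>
      near \<open>x\<close>, so the index selected at a nearby point lies in
      \<open>J\<close>.\<close>
    have "\<forall>\<^sub>F y in at x within D. \<forall>i\<in>I - J. G i y - \<phi> y \<noteq> 0"
    proof (rule eventually_ball_finite)
      show "\<forall>i\<in>I - J. \<forall>\<^sub>F y in at x within D. G i y - \<phi> y \<noteq> 0"
      proof
        fix i assume i: "i \<in> I - J"
        have "((\<lambda>y. G i y - \<phi> y) \<longlongrightarrow> G i x - \<phi> x) (at x within D)"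
          using contG'[of i] cont x i by (intro tendsto_diff) (auto simp: continuous_on_def)
        moreover have "G i x - \<phi> x \<noteq> 0" using i by (auto simp: J_def)
        ultimately show "\<forall>\<^sub>F y in at x within D. G i y - \<phi> y \<noteq> 0"
          by (rule tendsto_imp_eventually_ne)
      qed
    qed (use fin in auto)
    moreover have "\<forall>\<^sub>F y in at x within D. y \<in> D" by (simp add: eventually_at_filter)
    ultimately show ?thesis
    proof eventually_elim
      case (elim y)
      then obtain i0 where i0: "i0 \<in> I" "\<phi> y = G i0 y" using sel by blast
      then have "i0 \<in> J" using elim by force
      \<comment> \<open>The summand of the selected index \<open>i0\<close> is
        \<open>G i0 y\<close>, which pays for \<open>\<phi> y\<close>; the leading
        \<open>G j0 y\<close> is absorbed by the maximum of index \<open>i0\<close>.\<close>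
      have "A y = G i0 y + G j0 y + (\<Sum>i\<in>I - {i0}. if i \<in> J then G i y else max (G i y) (G j0 y))"
        unfolding A_def using \<open>i0 \<in> J\<close> by (simp add: sum.remove[OF fin i0(1)])
      also have "\<dots> \<le> \<phi> y + max (G i0 y) (G j0 y) + (\<Sum>i\<in>I - {i0}. max (G i y) (G j0 y))"
        by (intro add_mono sum_mono) (auto simp: i0)
      also have "\<dots> = \<phi> y + (\<Sum>i\<in>I. max (G i y) (G j0 y))"
        by (simp add: sum.remove[OF fin i0(1)])
      finally show ?case .
    qed
  qed
  ultimately show "\<exists>s. \<forall>\<^sub>F y in at x within D. \<phi> y + (\<Sum>j\<in>I. \<Sum>i\<in>I. max (G i y) (G j y))
      \<ge> \<phi> x + (\<Sum>j\<in>I. \<Sum>i\<in>I. max (G i x) (G j x)) + s \<bullet> (y - x)"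
    unfolding split
    by (intro exI[of _ s]) (auto elim!: eventually_mono, use s in \<open>smt (verit)\<close>)
qed

text \<open>Adding the sum \<open>H\<close> of all \<open>h j\<close> cancels the concave part of
  every \<open>g i - h i\<close>, so that \<open>\<phi> + H\<close> selects among the convex
  functions \<open>G i\<close>.\<close>

lemma DC_selection:
  fixes g h :: "'i \<Rightarrow> 'a::euclidean_space \<Rightarrow> real"
  assumes fin: "finite I" and g: "\<And>i. i \<in> I \<Longrightarrow> convex_on UNIV (g i)"
    and h: "\<And>i. i \<in> I \<Longrightarrow> convex_on UNIV (h i)"
    and D: "convex D" and cont: "continuous_on D \<phi>"
    and sel: "\<And>x. x \<in> D \<Longrightarrow> \<exists>i\<in>I. \<phi> x = g i x - h i x"
  obtains Q where "convex_on UNIV Q" "convex_on D (\<lambda>x. \<phi> x + Q x)"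
proof -
  define H where "H x = (\<Sum>i\<in>I. h i x)" for x
  define G where "G i x = g i x + (\<Sum>j\<in>I - {i}. h j x)" for i x
  have H: "convex_on UNIV H" unfolding H_def by (intro convex_on_UNIV_sum h)
  have G: "convex_on UNIV (G i)" if "i \<in> I" for i
    unfolding G_def using that by (intro convex_on_add convex_on_UNIV_sum g h) auto
  have "convex_on D (\<lambda>x. (\<phi> x + H x) + (\<Sum>j\<in>I. \<Sum>i\<in>I. max (G i x) (G j x)))"
  proof (rule convex_on_selection_plus_max[OF fin G D])
    show "continuous_on D (\<lambda>x. \<phi> x + H x)"
      using convex_on_continuous[OF open_UNIV H] continuous_on_subset
      by (intro continuous_on_add cont) blast
    fix x assume "x \<in> D"
    then obtain i where "i \<in> I" "\<phi> x = g i x - h i x" using sel by blast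
    then show "\<exists>i\<in>I. \<phi> x + H x = G i x"
      by (intro bexI[of _ i]) (auto simp: H_def G_def sum.remove[OF fin])
  qed
  moreover have "convex_on UNIV (\<lambda>x. H x + (\<Sum>j\<in>I. \<Sum>i\<in>I. max (G i x) (G j x)))"
    by (intro convex_on_add H convex_on_UNIV_sum convex_on_max G)
  ultimately show ?thesis
    by (intro that[of "\<lambda>x. H x + (\<Sum>j\<in>I. \<Sum>i\<in>I. max (G i x) (G j x))"]) (simp_all add: add.assoc)
qed

text \<open>On the ball \<open>\<phi> + Q\<close> is convex and Lipschitz, hence has a convex
  extension to the whole space; subtracting \<open>Q\<close> extends \<open>\<phi>\<close>.\<close>

lemma DC_extension_from_ball:
  fixes \<phi> :: "'a::euclidean_space \<Rightarrow> real"
  assumes lip: "K-lipschitz_on (ball a R) \<phi>" and Q: "convex_on UNIV Q"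
    and P: "convex_on (ball a R) (\<lambda>x. \<phi> x + Q x)"
  obtains \<psi> where "DC_on UNIV \<psi>" "\<And>x. x \<in> ball a R \<Longrightarrow> \<psi> x = \<phi> x"
proof (cases "ball a R = {}")
  case True
  then show ?thesis
    using that[of "\<lambda>x. 0"] convex_on_const[of UNIV 0] unfolding DC_on_def by (metis UNIV_I convex_UNIV diff_zero empty_iff)
next
  case False
  obtain L where "L-lipschitz_on (ball a R) Q" using convex_on_UNIV_lipschitz_on_ball[OF Q] .
  then have "(K + L)-lipschitz_on (ball a R) (\<lambda>x. \<phi> x + Q x)" using lip by (rule lipschitz_on_add[rotated])
  then obtain P' where P': "convex_on UNIV P'" "\<And>x. x \<in> ball a R \<Longrightarrow> P' x = \<phi> x + Q x"
    using lipschitz_convex_extension[OF P _ False] by metis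
  show ?thesis
  proof (rule that[of "\<lambda>x. P' x - Q x"])
    show "DC_on UNIV (\<lambda>x. P' x - Q x)" using P' Q by (auto simp: DC_on_def)
  qed (use P' in simp)
qed

section \<open>An implicit function theorem for DC functions\<close>

text \<open>\<open>H\<close> is the supremum of the affine functions that support \<open>k\<close>
  on \<open>D\<close> at some point with slope bounded by \<open>L\<close>. The bound keeps the
  supremum finite away from \<open>D\<close>, so \<open>H\<close> is convex on the whole space
  although \<open>k\<close> itself is not assumed convex.\<close>

lemma ex_convex_affine_envelope:
  fixes k :: "'a::euclidean_space \<Rightarrow> real"
  obtains H where "convex_on UNIV H"
    "\<And>x s. \<lbrakk>x \<in> D; norm s \<le> L; \<And>y. y \<in> D \<Longrightarrow> k y \<ge> k x + s \<bullet> (y - x)\<rbrakk> \<Longrightarrow> H x = k x"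
proof -
  define T where "T = {(x, s). x \<in> D \<and> norm s \<le> L \<and> (\<forall>y\<in>D. k y \<ge> k x + s \<bullet> (y - x))}"
  define aff where "aff = (\<lambda>(x, s) y. k x + s \<bullet> (y - x))"
  define H where "H y = (SUP z\<in>T. aff z y)" for y
  have bdd: "bdd_above ((\<lambda>z. aff z y) ` T)" if x0: "x0 \<in> D" for x0 y
  proof (rule bdd_aboveI2)
    fix z assume "z \<in> T"
    then obtain x s where z: "z = (x, s)" "norm s \<le> L" "k x0 \<ge> k x + s \<bullet> (x0 - x)"
      using x0 by (auto simp: T_def)
    have "s \<bullet> (y - x0) \<le> norm s * norm (y - x0)" by (rule norm_cauchy_schwarz)
    also have "\<dots> \<le> L * norm (y - x0)" using z by (intro mult_right_mono) auto
    finally show "aff z y \<le> k x0 + L * norm (y - x0)"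
      using z by (simp add: aff_def inner_diff_right)
  qed
  show ?thesis
  proof (cases "T = {}")
    \<comment> \<open>Without any support point the second conclusion is vacuous, and a constant
      serves.\<close>
    case True
    then show ?thesis using that[of "\<lambda>x. 0"] by (auto simp: T_def convex_on_const)
  next
    case False
    then obtain x0 where x0: "x0 \<in> D" by (auto simp: T_def)
    have "convex_on UNIV H"
    proof
      fix t :: real and x y :: 'a assume t: "0 < t" "t < 1"
      show "H ((1 - t) *\<^sub>R x + t *\<^sub>R y) \<le> (1 - t) * H x + t * H y"
        unfolding H_def[of "(1 - t) *\<^sub>R x + t *\<^sub>R y"]
      proof (rule cSUP_least[OF False])
        fix z assume z: "z \<in> T"
        have "aff z ((1 - t) *\<^sub>R x + t *\<^sub>R y) = (1 - t) * aff z x + t * aff z y"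
          by (cases z) (simp add: aff_def algebra_simps)
        also have "\<dots> \<le> (1 - t) * H x + t * H y"
          unfolding H_def using t z bdd[OF x0] by (intro add_mono mult_left_mono cSUP_upper) auto
        finally show "aff z ((1 - t) *\<^sub>R x + t *\<^sub>R y) \<le> (1 - t) * H x + t * H y" .
      qed
    qed simp
    moreover have "H x = k x" if "x \<in> D" "norm s \<le> L" "\<And>y. y \<in> D \<Longrightarrow> k y \<ge> k x + s \<bullet> (y - x)" for x s
    proof (rule antisym)
      show "H x \<le> k x" unfolding H_def
        by (rule cSUP_least[OF False]) (use that in \<open>auto simp: T_def aff_def\<close>)
      have "(x, s) \<in> T" using that by (auto simp: T_def)
      then have "aff (x, s) x \<le> H x" unfolding H_def by (rule cSUP_upper[OF _ bdd[OF x0]])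
      then show "k x \<le> H x" by (simp add: aff_def)
    qed
    ultimately show ?thesis by (rule that)
  qed
qed

text \<open>Any subgradient \<open>b\<close> of \<open>h\<close> will do: by the growth of
  \<open>g - h\<close>, \<open>g\<close> then rises along \<open>v\<close> with slope at least
  \<open>b \<bullet> v + c\<close> for short times. Convexity of \<open>g\<close> extends this to
  the entire ray, where the slope can be realised by a subgradient of \<open>g\<close>.\<close>

lemma ex_subgradients_gap:
  fixes g h :: "'a::euclidean_space \<Rightarrow> real"
  assumes g: "convex_on UNIV g" and h: "convex_on UNIV h" and \<tau>0: "\<tau>0 > 0" and eq: "g p = h p"
    and grow: "\<And>t. 0 \<le> t \<Longrightarrow> t \<le> \<tau>0 \<Longrightarrow> g (p + t *\<^sub>R v) - h (p + t *\<^sub>R v) \<ge> c * t"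
  obtains u b where "\<And>y. g y \<ge> g p + u \<bullet> (y - p)" "\<And>y. h y \<ge> h p + b \<bullet> (y - p)" "u \<bullet> v \<ge> b \<bullet> v + c"
proof -
  obtain b where b: "\<And>y. h y \<ge> h p + b \<bullet> (y - p)" using ex_subgradient[OF h] by metis
  have small: "g p + (b \<bullet> v + c) * t \<le> g (p + t *\<^sub>R v)" if "0 \<le> t" "t \<le> \<tau>0" for t
    using grow[OF that] b[of "p + t *\<^sub>R v"] eq by (simp add: algebra_simps)
  have "g p + (b \<bullet> v + c) * t \<le> g (p + t *\<^sub>R v)" if "0 \<le> t" for t
  proof (cases "t \<le> \<tau>0")
    case False
    \<comment> \<open>Weight that places \<open>p + \<tau>0 *\<^sub>R v\<close> between
      \<open>p\<close> and \<open>p + t *\<^sub>R v\<close>.\<close>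
    define \<mu> where "\<mu> = \<tau>0 / t"
    have \<mu>: "0 < \<mu>" "\<mu> \<le> 1" "\<mu> * t = \<tau>0" using False \<tau>0 by (auto simp: \<mu>_def)
    have "p + \<tau>0 *\<^sub>R v = (1 - \<mu>) *\<^sub>R p + \<mu> *\<^sub>R (p + t *\<^sub>R v)"
      using \<mu>(3) by (simp add: algebra_simps)
    then have "g (p + \<tau>0 *\<^sub>R v) \<le> (1 - \<mu>) * g p + \<mu> * g (p + t *\<^sub>R v)"
      using convex_onD[OF g, of \<mu> p "p + t *\<^sub>R v"] \<mu> by simp
    then have "g p + (b \<bullet> v + c) * (\<mu> * t) \<le> (1 - \<mu>) * g p + \<mu> * g (p + t *\<^sub>R v)"
      using small[of \<tau>0] \<tau>0 \<mu> by simp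
    then have "\<mu> * (g p + (b \<bullet> v + c) * t) \<le> \<mu> * g (p + t *\<^sub>R v)"
      by (simp add: algebra_simps)
    then show ?thesis using \<mu>(1) by simp
  qed (use small that in auto)
  then obtain u where "\<And>y. g y \<ge> g p + u \<bullet> (y - p)" "u \<bullet> v \<ge> b \<bullet> v + c"
    using ex_subgradient_slope_ge[OF g] by metis
  then show ?thesis using b that by metis
qed

text \<open>On the graph \<open>g\<close> and \<open>h\<close> agree, so the subgradient
  inequalities for \<open>u\<close> and for \<open>b\<close> both bound the same function
  \<open>k\<close> from below. Their convex combinations support
  \<open>k - \<alpha> * \<theta>\<close> for every \<open>\<alpha>\<close> between
  \<open>b \<bullet> v\<close> and \<open>u \<bullet> v\<close>. Two envelopes with consecutive grid
  values of \<open>\<alpha>\<close> then determine \<open>\<theta>\<close>.\<close>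

lemma DC_implicit_function:
  fixes g h :: "'a::euclidean_space \<Rightarrow> real"
  assumes g: "convex_on UNIV g" and h: "convex_on UNIV h"
    and lip: "K-lipschitz_on (ball a \<rho>) \<theta>" and c: "c > 0" and \<tau>0: "\<tau>0 > 0"
    and zero: "\<And>x. x \<in> ball a \<rho> \<Longrightarrow> g (x + \<theta> x *\<^sub>R v) = h (x + \<theta> x *\<^sub>R v)"
    and grow: "\<And>x t. \<lbrakk>x \<in> ball a \<rho>; 0 \<le> t; t \<le> \<tau>0\<rbrakk> \<Longrightarrow>
        g (x + (\<theta> x + t) *\<^sub>R v) - h (x + (\<theta> x + t) *\<^sub>R v) \<ge> c * t"
  obtains \<psi> where "DC_on UNIV \<psi>" "\<And>x. x \<in> ball a \<rho> \<Longrightarrow> \<psi> x = \<theta> x"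
proof -
  let ?D = "ball a \<rho>"
  define \<gamma> where "\<gamma> x = x + \<theta> x *\<^sub>R v" for x
  have "bounded (\<theta> ` ?D)"
    by (rule bounded_uniformly_continuous_image[OF lipschitz_on_uniformly_continuous[OF lip] bounded_ball])
  then obtain M where M: "\<And>x. x \<in> ?D \<Longrightarrow> \<bar>\<theta> x\<bar> \<le> M"
    unfolding bounded_iff by (metis imageI real_norm_def)
  \<comment> \<open>Large enough for the ball to contain the whole graph, so that subgradients at
    all graph points share a bound.\<close>
  define R where "R = \<rho> + M * norm v + 1"
  have \<gamma>R: "\<gamma> x \<in> ball a R" if "x \<in> ?D" for x
  proof -
    have "dist a (\<gamma> x) \<le> dist a x + dist x (\<gamma> x)" by (rule dist_triangle)
    moreover have "dist x (\<gamma> x) \<le> M * norm v"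
      using M[OF that] by (simp add: \<gamma>_def dist_norm mult_right_mono)
    ultimately show ?thesis using that by (simp add: R_def)
  qed
  obtain L1 where L1: "\<And>p u. \<lbrakk>p \<in> ball a R; \<And>y. g y \<ge> g p + u \<bullet> (y - p)\<rbrakk> \<Longrightarrow> norm u \<le> L1"
    using subgradients_bounded_on_ball[OF g] by metis
  obtain L2 where L2: "\<And>p u. \<lbrakk>p \<in> ball a R; \<And>y. h y \<ge> h p + u \<bullet> (y - p)\<rbrakk> \<Longrightarrow> norm u \<le> L2"
    using subgradients_bounded_on_ball[OF h] by metis
  define L where "L = max L1 L2"
  define k where "k x = g (\<gamma> x)" for x
  \<comment> \<open>An interval of length at least \<open>c\<close> contains two consecutive
    multiples of \<open>c / 2\<close>.\<close>
  define \<delta> where "\<delta> = c / 2"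
  have \<delta>: "\<delta> > 0" using c by (simp add: \<delta>_def)
  \<comment> \<open>The slopes \<open>b \<bullet> v\<close> are at most \<open>L * norm v\<close> in
    absolute value, so finitely many grid indices suffice for all points of the ball.\<close>
  define N where "N = \<lceil>L * norm v / \<delta>\<rceil> + 1"
  have "\<exists>H. convex_on UNIV H \<and> (\<forall>x s. x \<in> ?D \<longrightarrow> norm s \<le> L \<longrightarrow>
      (\<forall>y\<in>?D. k y - real_of_int j * \<delta> * \<theta> y \<ge> k x - real_of_int j * \<delta> * \<theta> x + s \<bullet> (y - x)) \<longrightarrow>
      H x = k x - real_of_int j * \<delta> * \<theta> x)" for j :: int
    using ex_convex_affine_envelope[of ?D L "\<lambda>x. k x - real_of_int j * \<delta> * \<theta> x"] by metis
  then obtain H where convH: "\<And>j::int. convex_on UNIV (H j)"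
    and H: "\<And>j x s. \<lbrakk>x \<in> ?D; norm s \<le> L;
      \<forall>y\<in>?D. k y - real_of_int j * \<delta> * \<theta> y \<ge> k x - real_of_int j * \<delta> * \<theta> x + s \<bullet> (y - x)\<rbrakk> \<Longrightarrow>
      H j x = k x - real_of_int j * \<delta> * \<theta> x"
    by metis
  have sel: "\<exists>j\<in>{-N..N}. \<theta> x = H j x / \<delta> - H (j + 1) x / \<delta>" if x: "x \<in> ?D" for x
  proof -
    obtain u b where u: "\<And>y. g y \<ge> g (\<gamma> x) + u \<bullet> (y - \<gamma> x)" and b: "\<And>y. h y \<ge> h (\<gamma> x) + b \<bullet> (y - \<gamma> x)"
      and gap: "u \<bullet> v \<ge> b \<bullet> v + c"
    proof (rule ex_subgradients_gap[OF g h \<tau>0, where p = "\<gamma> x" and v = v and c = c])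
      show "g (\<gamma> x) = h (\<gamma> x)" using zero[OF x] by (simp add: \<gamma>_def)
      show "c * t \<le> g (\<gamma> x + t *\<^sub>R v) - h (\<gamma> x + t *\<^sub>R v)" if "0 \<le> t" "t \<le> \<tau>0" for t
        using grow[OF x that] by (simp add: \<gamma>_def algebra_simps)
    qed auto
    have nu: "norm u \<le> L" "norm b \<le> L"
      using L1[OF \<gamma>R[OF x] u] L2[OF \<gamma>R[OF x] b] by (auto simp: L_def)
    have \<gamma>diff: "\<gamma> y - \<gamma> x = (y - x) + (\<theta> y - \<theta> x) *\<^sub>R v" for y by (simp add: \<gamma>_def algebra_simps)
    have ku: "k y \<ge> k x + u \<bullet> (y - x) + (u \<bullet> v) * (\<theta> y - \<theta> x)" for y
      using u[of "\<gamma> y"] unfolding k_def \<gamma>diff by (simp add: inner_add_right algebra_simps)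
    have kb: "k y \<ge> k x + b \<bullet> (y - x) + (b \<bullet> v) * (\<theta> y - \<theta> x)" if "y \<in> ?D" for y
    proof -
      have "k x = h (\<gamma> x)" "k y = h (\<gamma> y)" using zero[OF x] zero[OF that] by (simp_all add: k_def \<gamma>_def)
      then show ?thesis using b[of "\<gamma> y"] unfolding \<gamma>diff by (simp add: inner_add_right algebra_simps)
    qed
    have Heq: "H j x = k x - real_of_int j * \<delta> * \<theta> x"
      if j: "b \<bullet> v \<le> real_of_int j * \<delta>" "real_of_int j * \<delta> \<le> u \<bullet> v" for j
    proof -
      \<comment> \<open>The weight of \<open>u\<close> for which the mixed slope along
        \<open>v\<close> is exactly the grid value.\<close>
      define \<mu> where "\<mu> = (real_of_int j * \<delta> - b \<bullet> v) / (u \<bullet> v - b \<bullet> v)"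
      have pos: "u \<bullet> v - b \<bullet> v > 0" using gap c by simp
      have \<mu>: "0 \<le> \<mu>" "\<mu> \<le> 1" using j pos by (auto simp: \<mu>_def divide_simps)
      have j\<mu>: "real_of_int j * \<delta> = (1 - \<mu>) * (b \<bullet> v) + \<mu> * (u \<bullet> v)"
      proof -
        have "\<mu> * (u \<bullet> v - b \<bullet> v) = real_of_int j * \<delta> - b \<bullet> v" using pos by (simp add: \<mu>_def)
        then show ?thesis by (simp add: algebra_simps)
      qed
      show ?thesis
      proof (rule H[OF x, of "(1 - \<mu>) *\<^sub>R b + \<mu> *\<^sub>R u"])
        have "norm ((1 - \<mu>) *\<^sub>R b + \<mu> *\<^sub>R u) \<le> (1 - \<mu>) * norm b + \<mu> * norm u"
          using norm_triangle_ineq[of "(1 - \<mu>) *\<^sub>R b" "\<mu> *\<^sub>R u"] \<mu> by simp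
        also have "\<dots> \<le> (1 - \<mu>) * L + \<mu> * L" using nu \<mu> by (intro add_mono mult_left_mono) auto
        finally show "norm ((1 - \<mu>) *\<^sub>R b + \<mu> *\<^sub>R u) \<le> L" by (simp add: algebra_simps)
        show "\<forall>y\<in>?D. k x - real_of_int j * \<delta> * \<theta> x + ((1 - \<mu>) *\<^sub>R b + \<mu> *\<^sub>R u) \<bullet> (y - x)
            \<le> k y - real_of_int j * \<delta> * \<theta> y"
        proof
          fix y assume y: "y \<in> ?D"
          have "(1 - \<mu>) * (k x + b \<bullet> (y - x) + (b \<bullet> v) * (\<theta> y - \<theta> x))
              + \<mu> * (k x + u \<bullet> (y - x) + (u \<bullet> v) * (\<theta> y - \<theta> x)) \<le> (1 - \<mu>) * k y + \<mu> * k y"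
            using \<mu> ku[of y] kb[OF y] by (intro add_mono mult_left_mono) auto
          moreover have "(1 - \<mu>) * (k x + b \<bullet> (y - x) + (b \<bullet> v) * (\<theta> y - \<theta> x))
              + \<mu> * (k x + u \<bullet> (y - x) + (u \<bullet> v) * (\<theta> y - \<theta> x))
              = k x + ((1 - \<mu>) *\<^sub>R b + \<mu> *\<^sub>R u) \<bullet> (y - x) + (real_of_int j * \<delta>) * (\<theta> y - \<theta> x)"
            unfolding j\<mu> by (simp add: inner_add_left algebra_simps)
          ultimately show "k x - real_of_int j * \<delta> * \<theta> x + ((1 - \<mu>) *\<^sub>R b + \<mu> *\<^sub>R u) \<bullet> (y - x)
            \<le> k y - real_of_int j * \<delta> * \<theta> y" by (simp add: algebra_simps)
        qed
      qed
    qed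
    define j where "j = \<lceil>(b \<bullet> v) / \<delta>\<rceil>"
    have j: "b \<bullet> v \<le> real_of_int j * \<delta>" "real_of_int j * \<delta> < b \<bullet> v + \<delta>"
    proof -
      have "(b \<bullet> v) / \<delta> \<le> real_of_int j" "real_of_int j < (b \<bullet> v) / \<delta> + 1"
        unfolding j_def by linarith+
      then show "b \<bullet> v \<le> real_of_int j * \<delta>" "real_of_int j * \<delta> < b \<bullet> v + \<delta>"
        using \<delta> by (simp_all add: field_simps)
    qed
    have "H j x = k x - real_of_int j * \<delta> * \<theta> x"
      by (rule Heq) (use j gap c in \<open>auto simp: \<delta>_def\<close>)
    moreover have "H (j + 1) x = k x - real_of_int (j + 1) * \<delta> * \<theta> x"
      by (rule Heq) (use j gap \<delta> in \<open>auto simp: \<delta>_def algebra_simps\<close>)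
    \<comment> \<open>Subtracting the two values cancels \<open>k x\<close> and leaves
      \<open>\<delta> * \<theta> x\<close>.\<close>
    ultimately have "\<theta> x = H j x / \<delta> - H (j + 1) x / \<delta>"
      using \<delta> by (simp add: field_simps)
    moreover have "j \<in> {-N..N}"
    proof -
      have "\<bar>b \<bullet> v\<bar> \<le> norm b * norm v" by (rule Cauchy_Schwarz_ineq2)
      also have "\<dots> \<le> L * norm v" using nu by (intro mult_right_mono) auto
      finally have "\<bar>(b \<bullet> v) / \<delta>\<bar> \<le> L * norm v / \<delta>" using \<delta> by (simp add: divide_right_mono)
      then show ?thesis unfolding j_def N_def by (simp, linarith)
    qed
    ultimately show ?thesis by blast
  qed
  have "convex_on UNIV (\<lambda>x. H j x / \<delta>)" for j
    using convex_on_cdiv[OF _ convH[of j], of \<delta>] \<delta> by simp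
  then obtain Q where "convex_on UNIV Q" "convex_on ?D (\<lambda>x. \<theta> x + Q x)"
    using DC_selection[of "{-N..N}" "\<lambda>j x. H j x / \<delta>" "\<lambda>j x. H (j + 1) x / \<delta>" ?D \<theta>]
      sel lipschitz_on_continuous_on[OF lip] by (metis convex_ball finite_atLeastAtMost_int)
  then show ?thesis using DC_extension_from_ball[OF lip] that by metis
qed

section \<open>Clarke subgradients and weak regularity\<close>

text \<open>The limit superior in the Clarke derivative lets the base point move. Hence it tolerates
  a shift proportional to \<open>t\<close> and a rescaled step, which is what its subadditivity
  rests on.\<close>

lemma filterlim_clarke_shift:
  fixes y w :: "'a::real_normed_vector"
  assumes "b > 0"
  shows "filterlim (\<lambda>(z, t). (z + (c * t) *\<^sub>R w, b * t)) (nhds y \<times>\<^sub>F at_right (0::real)) (nhds y \<times>\<^sub>F at_right 0)"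
proof -
  let ?F = "nhds y \<times>\<^sub>F at_right (0::real)"
  have fst: "(fst \<longlongrightarrow> y) ?F" by (rule filterlim_fst)
  have snd: "filterlim snd (at_right 0) ?F" by (rule filterlim_snd)
  then have snd0: "(snd \<longlongrightarrow> 0) ?F" and snd_pos: "\<forall>\<^sub>F p in ?F. snd p > 0"
    by (auto simp: filterlim_at elim: eventually_mono)
  have "((\<lambda>p. fst p + (c * snd p) *\<^sub>R w) \<longlongrightarrow> y + (c * 0) *\<^sub>R w) ?F"
    by (intro tendsto_intros fst snd0)
  moreover have "((\<lambda>p. b * snd p) \<longlongrightarrow> b * 0) ?F" by (intro tendsto_intros snd0)
  then have "filterlim (\<lambda>p. b * snd p) (at_right 0) ?F"
    using snd_pos assms by (auto simp: filterlim_at elim: eventually_mono)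
  ultimately show ?thesis
    by (simp add: case_prod_unfold filterlim_Pair)
qed

text \<open>The strict epigraph of the Clarke directional derivative is convex; it is separated
  from the hypograph of \<open>w \<mapsto> - e * norm w\<close>.\<close>

lemma ex_small_clarke_subgradient:
  fixes f :: "'a::euclidean_space \<Rightarrow> real"
  assumes lower: "\<forall>\<^sub>F z in nhds y. f z \<ge> f y - e * dist z y"
    and e: "e \<ge> 0"
  obtains u where "u \<in> clarke_subdiff f y" "norm u \<le> e"
proof -
  let ?F = "nhds y \<times>\<^sub>F at_right (0::real)"
  define q where "q w = (\<lambda>(z, t). (f (z + t *\<^sub>R w) - f z) / t)" for w
  define S where "S = {p. \<forall>\<^sub>F zt in ?F. q (fst p) zt < snd p}"
  define T where "T = {p :: 'a \<times> real. snd p \<le> - e * norm (fst p)}"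
  have tpos: "\<forall>\<^sub>F zt in ?F. snd zt > 0"
    using filterlim_snd[of "at_right (0::real)" "nhds y"] by (auto simp: filterlim_at elim: eventually_mono)
  have "convex S"
  proof (rule convexI)
    fix p1 p2 :: "'a \<times> real" and a b :: real
    assume p: "p1 \<in> S" "p2 \<in> S" and ab: "a \<ge> 0" "b \<ge> 0" "a + b = 1"
    show "a *\<^sub>R p1 + b *\<^sub>R p2 \<in> S"
    proof (cases "a = 0 \<or> b = 0")
      case False
      then have ab': "a > 0" "b > 0" using ab by auto
      define w1 w2 where "w1 = fst p1" and "w2 = fst p2"
      \<comment> \<open>The increment along the combined direction is split at
        \<open>z + (a * t) *\<^sub>R w1\<close>; each piece is again a difference quotient near
        \<open>y\<close>, with step \<open>a * t\<close> or \<open>b * t\<close>.\<close>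
      have "\<forall>\<^sub>F zt in ?F. q w1 ((\<lambda>(z, t). (z + (0 * t) *\<^sub>R w1, a * t)) zt) < snd p1"
        using p(1) filterlim_clarke_shift[OF ab'(1), of 0 w1 y]
        by (auto simp: S_def w1_def filterlim_iff simp del: mult_zero_left)
      moreover have "\<forall>\<^sub>F zt in ?F. q w2 ((\<lambda>(z, t). (z + (a * t) *\<^sub>R w1, b * t)) zt) < snd p2"
        using p(2) filterlim_clarke_shift[OF ab'(2), of a w1 y]
        by (auto simp: S_def w2_def filterlim_iff)
      ultimately have "\<forall>\<^sub>F zt in ?F. q (a *\<^sub>R w1 + b *\<^sub>R w2) zt < a * snd p1 + b * snd p2"
        using tpos
      proof eventually_elim
        case (elim zt)
        obtain z t where zt: "zt = (z, t)" by (cases zt)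
        have t: "t > 0" using elim zt by simp
        have q1: "a * q w1 (z, a * t) = (f (z + (a * t) *\<^sub>R w1) - f z) / t"
          using t ab' by (simp add: q_def)
        have q2: "b * q w2 (z + (a * t) *\<^sub>R w1, b * t)
            = (f (z + (a * t) *\<^sub>R w1 + (b * t) *\<^sub>R w2) - f (z + (a * t) *\<^sub>R w1)) / t"
          using t ab' by (simp add: q_def)
        have "z + t *\<^sub>R (a *\<^sub>R w1 + b *\<^sub>R w2) = z + (a * t) *\<^sub>R w1 + (b * t) *\<^sub>R w2"
          by (simp add: scaleR_add_right mult.commute)
        then have "q (a *\<^sub>R w1 + b *\<^sub>R w2) zt = (f (z + (a * t) *\<^sub>R w1 + (b * t) *\<^sub>R w2) - f z) / t"
          by (simp only: q_def zt prod.case)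
        also have "\<dots> = a * q w1 (z, a * t) + b * q w2 (z + (a * t) *\<^sub>R w1, b * t)"
          unfolding q1 q2 by (simp add: diff_divide_distrib)
        also have "\<dots> < a * snd p1 + b * snd p2"
          using elim ab' by (intro add_strict_mono mult_strict_left_mono) (auto simp: zt)
        finally show ?case .
      qed
      then show ?thesis by (simp add: S_def w1_def w2_def)
    next
      case True
      then have "a = 0 \<and> b = 1 \<or> a = 1 \<and> b = 0" using ab(3) by auto
      then show ?thesis using p by auto
    qed
  qed
  moreover have "convex T"
  proof (rule convexI)
    fix p1 p2 :: "'a \<times> real" and a b :: real
    assume p: "p1 \<in> T" "p2 \<in> T" and ab: "a \<ge> 0" "b \<ge> 0" "a + b = 1"
    have "e * norm (a *\<^sub>R fst p1 + b *\<^sub>R fst p2) \<le> e * (a * norm (fst p1) + b * norm (fst p2))"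
      using norm_triangle_ineq[of "a *\<^sub>R fst p1" "b *\<^sub>R fst p2"] ab e by (intro mult_left_mono) auto
    moreover have "a * snd p1 + b * snd p2 \<le> a * (- e * norm (fst p1)) + b * (- e * norm (fst p2))"
      using p ab by (intro add_mono mult_left_mono) (auto simp: T_def)
    ultimately show "a *\<^sub>R p1 + b *\<^sub>R p2 \<in> T" by (simp add: T_def algebra_simps)
  qed
  moreover have S0: "(0, s) \<in> S" if "s > 0" for s
    using that by (auto simp: S_def q_def case_prod_unfold)
  moreover have "(0, 0) \<in> T" by (simp add: T_def)
  moreover have "S \<inter> T = {}"
  proof (rule ccontr)
    assume "S \<inter> T \<noteq> {}"
    then obtain w s where ws: "\<forall>\<^sub>F zt in ?F. q w zt < s" "s \<le> - e * norm w"
      by (auto simp: S_def T_def)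
    then obtain P Q where "eventually P (nhds y)" "eventually Q (at_right 0)" "\<And>z t. P z \<Longrightarrow> Q t \<Longrightarrow> q w (z, t) < s"
      unfolding eventually_prod_filter by metis
    \<comment> \<open>The base point is frozen at \<open>y\<close>, because the lower bound on
      \<open>f\<close> is relative to \<open>f y\<close>.\<close>
    then have "\<forall>\<^sub>F t in at_right 0. q w (y, t) < s"
      by (metis (mono_tags, lifting) eventually_mono eventually_nhds_x_imp_x)
    moreover have "((\<lambda>t. y + t *\<^sub>R w) \<longlongrightarrow> y + 0 *\<^sub>R w) (at_right (0::real))"
      by (intro tendsto_intros)
    then have "filterlim (\<lambda>t. y + t *\<^sub>R w) (nhds y) (at_right (0::real))" by simp
    then have "\<forall>\<^sub>F t in at_right (0::real). f (y + t *\<^sub>R w) \<ge> f y - e * dist (y + t *\<^sub>R w) y"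
      using lower by (auto simp: filterlim_iff)
    moreover have "\<forall>\<^sub>F t in at_right (0::real). t > 0" by (simp add: eventually_at_right_less)
    ultimately have "\<forall>\<^sub>F t in at_right (0::real). False"
    proof eventually_elim
      case (elim t)
      then have "f (y + t *\<^sub>R w) - f y \<ge> - (e * (t * norm w))" by (simp add: dist_norm)
      then have "q w (y, t) \<ge> - e * norm w" using elim by (simp add: q_def field_simps)
      then show ?case using elim ws(2) by linarith
    qed
    then show False by simp
  qed
  ultimately obtain d k where dk: "d \<noteq> 0" "\<forall>x\<in>S. d \<bullet> x \<ge> k" "\<forall>x\<in>T. d \<bullet> x \<le> k"
    using separating_hyperplane_sets[of T S] by (metis Int_commute empty_iff zero_less_one)
  obtain w0 \<sigma> where d: "d = (w0, \<sigma>)" by (cases d)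
  have S: "w0 \<bullet> w + \<sigma> * s \<ge> k" if "(w, s) \<in> S" for w s using dk(2) that by (auto simp: d)
  have T: "w0 \<bullet> w + \<sigma> * s \<le> k" if "s \<le> - e * norm w" for w s
    using dk(3) that by (auto simp: d T_def)
  have k0: "k \<ge> 0" using T[of 0 0] by simp
  have "\<sigma> > 0"
  proof (rule ccontr)
    assume "\<not> \<sigma> > 0"
    moreover have "\<sigma> \<ge> 0" using S[OF S0[of 1]] k0 by simp
    ultimately have "\<sigma> = 0" by simp
    then have "w0 \<bullet> w0 \<le> k" "k \<le> 0" using T[of "- e * norm w0" w0] S[OF S0[of 1]] by simp_all
    then have "w0 \<bullet> w0 \<le> 0" by linarith
    then have "w0 = 0" by (metis inner_gt_zero_iff not_le)
    then show False using dk(1) \<open>\<sigma> = 0\<close> by (simp add: d zero_prod_def)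
  qed
  have "k \<le> 0"
  proof (rule ccontr)
    assume "\<not> k \<le> 0"
    then have "k \<le> \<sigma> * (k / (2 * \<sigma>))" using S[OF S0[of "k / (2 * \<sigma>)"]] \<open>\<sigma> > 0\<close> by simp
    then show False using \<open>\<not> k \<le> 0\<close> \<open>\<sigma> > 0\<close> by simp
  qed
  then have k: "k = 0" using k0 by simp
  define u where "u = - (w0 /\<^sub>R \<sigma>)"
  have w0: "w0 = - (\<sigma> *\<^sub>R u)" using \<open>\<sigma> > 0\<close> by (simp add: u_def)
  have Su: "u \<bullet> w \<le> s" if "(w, s) \<in> S" for w s
  proof -
    have "\<sigma> * (u \<bullet> w) \<le> \<sigma> * s" using S[OF that] by (simp add: k w0)
    then show ?thesis using \<open>\<sigma> > 0\<close> by simp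
  qed
  show ?thesis
  proof (rule that[of u])
    show "u \<in> clarke_subdiff f y" unfolding clarke_subdiff_def
    proof (intro CollectI allI)
      fix w
      show "ereal (u \<bullet> w) \<le> clarke_dir f y w"
      \<comment> \<open>If the derivative were below \<open>u \<bullet> w\<close>, a real number
        strictly between would give a point of \<open>S\<close> on the wrong side of the
        hyperplane.\<close>
      proof (rule ccontr)
        assume "\<not> ?thesis"
        then obtain s where s: "clarke_dir f y w < ereal s" "ereal s < ereal (u \<bullet> w)"
          by (metis ereal_dense2 not_le)
        from Limsup_lessD[OF s(1)[unfolded clarke_dir_def]] have "(w, s) \<in> S"
          by (simp add: S_def q_def case_prod_unfold)
        then show False using Su[of w s] s(2) by simp
      qed
    qed
    \<comment> \<open>Testing the hypograph in direction \<open>- u\<close> yields the norm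
      bound.\<close>
    have "\<sigma> * (u \<bullet> u) \<le> \<sigma> * (e * norm u)" using T[of "- e * norm (- u)" "- u"] by (simp add: k w0)
    then have "norm u * norm u \<le> e * norm u" using \<open>\<sigma> > 0\<close> by (simp add: dot_square_norm power2_eq_square)
    then show "norm u \<le> e" using e by (cases "u = 0") auto
  qed
qed

section \<open>Error bounds from weak regularity\<close>

text \<open>Otherwise violations with radius and bound both \<open>1 / Suc n\<close> give points
  tending to \<open>a\<close> whose subgradients tend to 0, against weak regularity.\<close>

lemma weakly_regular_value_locally_uniform:
  fixes f :: "'a::euclidean_space \<Rightarrow> real"
  assumes reg: "weakly_regular_value f 0" and a: "f a = 0"
  obtains \<epsilon> \<rho> where "\<epsilon> > 0" "\<rho> > 0"
    "\<And>x u. \<lbrakk>x \<in> ball a \<rho>; f x > 0; u \<in> clarke_subdiff f x\<rbrakk> \<Longrightarrow> \<epsilon> \<le> norm u"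
proof (rule ccontr)
  assume "\<not> thesis"
  then have "\<exists>x u. x \<in> ball a (1 / Suc n) \<and> f x > 0 \<and> u \<in> clarke_subdiff f x \<and> norm u < 1 / Suc n" for n
    using that[of "1 / Suc n" "1 / Suc n"] by (force simp: not_le)
  then obtain xs us where xs: "\<And>n. xs n \<in> ball a (1 / Suc n)" "\<And>n. f (xs n) > 0"
    and us: "\<And>n. us n \<in> clarke_subdiff f (xs n)" "\<And>n. norm (us n) < 1 / Suc n"
    by metis
  have lim0: "(\<lambda>n. 1 / real (Suc n)) \<longlonglongrightarrow> 0" using LIMSEQ_Suc[OF lim_1_over_n] by simp
  have "xs \<longlonglongrightarrow> a"
    by (rule metric_tendsto_imp_tendsto[OF lim0])
      (use xs(1) in \<open>auto simp: dist_commute intro!: always_eventually less_imp_le\<close>)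
  then have "Liminf sequentially (\<lambda>n. ereal (norm (us n))) > 0"
    using reg xs us a unfolding weakly_regular_value_def by blast
  moreover have "(\<lambda>n. norm (us n)) \<longlonglongrightarrow> 0"
    by (rule tendsto_sandwich[OF _ _ tendsto_const lim0])
      (use us(2) in \<open>auto simp del: of_nat_Suc intro!: always_eventually less_imp_le\<close>)
  then have "(\<lambda>n. ereal (norm (us n))) \<longlonglongrightarrow> ereal 0" by simp
  then have "Liminf sequentially (\<lambda>n. ereal (norm (us n))) = 0"
    by (simp add: lim_imp_Liminf zero_ereal_def)
  ultimately show False by simp
qed

text \<open>An Ekeland-type argument on a compact ball: a minimiser of \<open>f\<close> plus
  \<open>e\<close> times the distance to \<open>x\<close> has a Clarke subgradient of norm at most
  \<open>e\<close> if it is interior. It is interior when \<open>f x < e * \<delta>\<close>, since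
  \<open>f\<close> is positive there.\<close>

lemma clarke_error_bound:
  fixes f :: "'a::euclidean_space \<Rightarrow> real"
  assumes cont: "continuous_on UNIV f" and e: "0 \<le> e" "e < \<epsilon>" and \<delta>: "\<delta> \<ge> 0"
    and pos: "\<And>z. z \<in> cball x \<delta> \<Longrightarrow> f z > 0"
    and reg: "\<And>z u. \<lbrakk>z \<in> cball x \<delta>; u \<in> clarke_subdiff f z\<rbrakk> \<Longrightarrow> \<epsilon> \<le> norm u"
  shows "f x \<ge> e * \<delta>"
proof (rule ccontr)
  assume less: "\<not> f x \<ge> e * \<delta>"
  have cont': "continuous_on (cball x \<delta>) (\<lambda>z. f z + e * dist z x)"
    using continuous_on_subset[OF cont] by (intro continuous_intros) auto
  have "cball x \<delta> \<noteq> {}" using \<delta> by simp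
  from continuous_attains_inf[OF compact_cball this cont'] obtain y where y: "y \<in> cball x \<delta>"
    and ymin: "\<And>z. z \<in> cball x \<delta> \<Longrightarrow> f y + e * dist y x \<le> f z + e * dist z x"
    by blast
  have "e * dist y x < e * \<delta>" using ymin[of x] pos[OF y] less \<delta> by simp
  then have "y \<in> ball x \<delta>" using e by (auto simp: dist_commute mult_less_cancel_left)
  then have "\<forall>\<^sub>F z in nhds y. z \<in> ball x \<delta>" by (rule eventually_nhds_in_open[OF open_ball])
  then have "\<forall>\<^sub>F z in nhds y. f z \<ge> f y - e * dist z y"
  proof eventually_elim
    case (elim z)
    have "e * dist z x \<le> e * (dist z y + dist y x)" by (intro mult_left_mono dist_triangle e)
    moreover have "f y + e * dist y x \<le> f z + e * dist z x" using ymin elim by simp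
    ultimately show ?case by (simp add: algebra_simps)
  qed
  then obtain u where "u \<in> clarke_subdiff f y" "norm u \<le> e"
    using ex_small_clarke_subgradient e(1) by blast
  then show False using reg[OF y] e by fastforce
qed

lemma weakly_regular_valueI_bound:
  assumes "\<epsilon> > 0" "\<And>x u. \<lbrakk>f x > c; u \<in> clarke_subdiff f x\<rbrakk> \<Longrightarrow> \<epsilon> \<le> norm u"
  shows "weakly_regular_value f c"
  unfolding weakly_regular_value_def
proof (intro allI impI)
  fix xs :: "nat \<Rightarrow> 'a" and x us
  assume "\<forall>i. f (xs i) > c" "\<forall>i. us i \<in> clarke_subdiff f (xs i)"
  then have "\<forall>\<^sub>F i in sequentially. ereal \<epsilon> \<le> ereal (norm (us i))" using assms by (intro always_eventually) auto
  then have "ereal \<epsilon> \<le> Liminf sequentially (\<lambda>i. ereal (norm (us i)))" by (rule Liminf_bounded)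
  moreover have "0 < ereal \<epsilon>" using assms by simp
  ultimately show "Liminf sequentially (\<lambda>i. ereal (norm (us i))) > 0" by (rule less_le_trans[rotated])
qed

section \<open>Graph domains\<close>

text \<open>For a unit vector \<open>v\<close> this is the orthogonal projection onto the hyperplane
  orthogonal to \<open>v\<close>. It turns functions on that hyperplane into functions on the whole
  space.\<close>

definition drop_along :: "'a::euclidean_space \<Rightarrow> 'a \<Rightarrow> 'a" where
  "drop_along v x = x - (v \<bullet> x) *\<^sub>R v"

lemma linear_drop_along: "linear (drop_along v)"
  by (rule linearI) (simp_all add: drop_along_def inner_add_right algebra_simps)

lemma inner_drop_along: "norm v = 1 \<Longrightarrow> v \<bullet> drop_along v x = 0"
  by (simp add: drop_along_def inner_diff_right dot_square_norm)

lemma drop_along_add: "drop_along v x + (v \<bullet> x) *\<^sub>R v = x"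
  by (simp add: drop_along_def)

lemma drop_along_shift: "norm v = 1 \<Longrightarrow> drop_along v (x + t *\<^sub>R v) = drop_along v x"
  by (simp add: drop_along_def inner_add_right dot_square_norm algebra_simps)

lemma drop_along_orthogonal: "v \<bullet> w = 0 \<Longrightarrow> drop_along v w = w"
  by (simp add: drop_along_def)

lemma norm_drop_along_le:
  assumes v: "norm v = 1"
  shows "norm (drop_along v x) \<le> norm x"
proof -
  have "orthogonal (drop_along v x) ((v \<bullet> x) *\<^sub>R v)"
    using inner_drop_along[OF v, of x] by (simp add: orthogonal_def inner_commute)
  from norm_add_Pythagorean[OF this] have "(norm (drop_along v x))\<^sup>2 \<le> (norm x)\<^sup>2"
    by (simp add: drop_along_add)
  then show ?thesis by (rule power2_le_imp_le) simp
qed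

lemma dist_drop_along_le: "norm v = 1 \<Longrightarrow> dist (drop_along v x) (drop_along v y) \<le> dist x y"
  using norm_drop_along_le[of v "x - y"] by (simp add: dist_norm linear_diff[OF linear_drop_along])

text \<open>By dimension \<open>W\<close> is determined by \<open>v\<close>, so graph domains can be
  handled through \<open>v\<close> and \<open>drop_along v\<close> alone.\<close>

lemma subspace_eq_orthogonal_hyperplane:
  fixes v :: "'a::euclidean_space"
  assumes "subspace W" "dim W = DIM('a) - 1" "norm v = 1" "\<forall>w\<in>W. v \<bullet> w = 0"
  shows "W = {w. v \<bullet> w = 0}"
proof (rule subspace_dim_equal)
  show "subspace {w. v \<bullet> w = 0}" by (rule subspace_hyperplane)
  have "v \<noteq> 0" using assms(3) by auto
  then show "dim {w. v \<bullet> w = 0} \<le> dim W" using assms(2) by (simp add: dim_hyperplane)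
qed (use assms in auto)

lemma subgraph_eq:
  assumes v: "norm v = 1"
  shows "{w + t *\<^sub>R v | w t. w \<in> {w. v \<bullet> w = 0} \<and> t \<le> \<phi> w} = {x. v \<bullet> x \<le> \<phi> (drop_along v x)}"
proof (intro equalityI subsetI)
  fix x assume "x \<in> {w + t *\<^sub>R v | w t. w \<in> {w. v \<bullet> w = 0} \<and> t \<le> \<phi> w}"
  then obtain w t where "x = w + t *\<^sub>R v" "v \<bullet> w = 0" "t \<le> \<phi> w" by auto
  then show "x \<in> {x. v \<bullet> x \<le> \<phi> (drop_along v x)}"
    using v by (simp add: drop_along_shift drop_along_orthogonal inner_add_right dot_square_norm)
next
  fix x assume "x \<in> {x. v \<bullet> x \<le> \<phi> (drop_along v x)}"
  then show "x \<in> {w + t *\<^sub>R v | w t. w \<in> {w. v \<bullet> w = 0} \<and> t \<le> \<phi> w}"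
    using inner_drop_along[OF v, of x] drop_along_add[of v x, symmetric] by blast
qed

lemma closed_graph_domainE:
  fixes A :: "'a::euclidean_space set"
  assumes "closed_graph_domain P A" "a \<in> frontier A"
  obtains r v \<phi> where "r > 0" "norm v = 1" "P {w. v \<bullet> w = 0} \<phi>"
    "\<And>x. x \<in> ball a r \<Longrightarrow> x \<in> A \<longleftrightarrow> v \<bullet> x \<le> \<phi> (drop_along v x)"
proof -
  from bspec[OF conjunct2[OF assms(1)[unfolded closed_graph_domain_def]] assms(2)]
  obtain r W v \<phi> where r: "r > 0" and W: "subspace W" "dim W = DIM('a) - 1" "norm v = 1"
    "\<forall>w\<in>W. v \<bullet> w = 0" and P: "P W \<phi>"
    and A: "A \<inter> ball a r = {w + t *\<^sub>R v | w t. w \<in> W \<and> t \<le> \<phi> w} \<inter> ball a r"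
    by (elim exE conjE) (rule that)
  have WH: "W = {w. v \<bullet> w = 0}" by (rule subspace_eq_orthogonal_hyperplane[OF W])
  show ?thesis
    by (rule that[OF r W(3) P[unfolded WH]])
      (use A[unfolded WH subgraph_eq[OF W(3)]] in \<open>auto simp: set_eq_iff\<close>)
qed

lemma closed_graph_domainI:
  fixes A :: "'a::euclidean_space set"
  assumes "closed A"
    and "\<And>a. a \<in> frontier A \<Longrightarrow> \<exists>r>0. \<exists>v \<phi>. norm v = 1 \<and> P {w. v \<bullet> w = 0} \<phi> \<and>
      (\<forall>x\<in>ball a r. x \<in> A \<longleftrightarrow> v \<bullet> x \<le> \<phi> (drop_along v x))"
  shows "closed_graph_domain P A"
  unfolding closed_graph_domain_def
proof (intro conjI ballI assms(1))
  fix a assume "a \<in> frontier A"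
  from assms(2)[OF this] obtain r v \<phi> where r: "r > 0" and v: "norm v = 1" and P: "P {w. v \<bullet> w = 0} \<phi>"
    and A: "\<forall>x\<in>ball a r. x \<in> A \<longleftrightarrow> v \<bullet> x \<le> \<phi> (drop_along v x)"
    by (elim exE conjE) (rule that)
  let ?W = "{w. v \<bullet> w = 0}"
  have "v \<noteq> 0" using v by auto
  have "A \<inter> ball a r = {w + t *\<^sub>R v | w t. w \<in> ?W \<and> t \<le> \<phi> w} \<inter> ball a r"
    unfolding subgraph_eq[OF v] using A by auto
  then show "\<exists>r>0. \<exists>W v \<phi>. subspace W \<and> dim W = DIM('a) - 1 \<and>
      norm v = 1 \<and> (\<forall>w\<in>W. v \<bullet> w = 0) \<and> P W \<phi> \<and>
      A \<inter> ball a r = {w + t *\<^sub>R v | w t. w \<in> W \<and> t \<le> \<phi> w} \<inter> ball a r"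
    using r v P subspace_hyperplane[of v] dim_hyperplane[OF \<open>v \<noteq> 0\<close>]
    by (intro exI[of _ r] conjI exI[of _ ?W] exI[of _ v] exI[of _ \<phi>]) simp_all
qed

section \<open>DC domains are locally WDC\<close>

lemma convex_on_compose_affine:
  fixes T :: "'a::real_vector \<Rightarrow> 'b::real_vector"
  assumes g: "convex_on S g" and T: "linear T" and TS: "\<And>x. T x + b \<in> S"
  shows "convex_on UNIV (\<lambda>x. g (T x + b))"
proof
  fix t :: real and x y assume t: "0 < t" "t < 1"
  have "T ((1 - t) *\<^sub>R x + t *\<^sub>R y) = (1 - t) *\<^sub>R T x + t *\<^sub>R T y"
    by (simp only: linear_add[OF T] linear_scale[OF T])
  then have "T ((1 - t) *\<^sub>R x + t *\<^sub>R y) + b = (1 - t) *\<^sub>R (T x + b) + t *\<^sub>R (T y + b)"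
    by (simp only:) (simp add: algebra_simps)
  then show "g (T ((1 - t) *\<^sub>R x + t *\<^sub>R y) + b) \<le> (1 - t) * g (T x + b) + t * g (T y + b)"
    using convex_onD[OF g, of t "T x + b" "T y + b"] t TS by simp
qed simp

lemma DC_on_UNIV_continuous:
  fixes f :: "'a::euclidean_space \<Rightarrow> real"
  assumes "DC_on UNIV f"
  shows "continuous_on UNIV f"
proof -
  obtain g h where gh: "convex_on UNIV g" "convex_on UNIV h" "\<And>x. f x = g x - h x"
    using assms by (auto simp: DC_on_def)
  have "continuous_on UNIV (\<lambda>x. g x - h x)"
    by (intro continuous_intros convex_on_continuous gh open_UNIV)
  then show ?thesis by (simp add: gh(3))
qed

text \<open>With \<open>\<phi> = g - h\<close>, the positive part of the height over the graph is a
  maximum of two convex functions minus \<open>g\<close>. Where it is positive it falls at rate 1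
  along \<open>- v\<close>, so every Clarke subgradient \<open>u\<close> satisfies
  \<open>u \<bullet> v \<ge> 1\<close>.\<close>

lemma DC_subgraph_WDC:
  fixes v :: "'a::euclidean_space"
  assumes v: "norm v = 1" and DC: "DC_on {w. v \<bullet> w = 0} \<phi>"
  shows "WDC_set {x. v \<bullet> x \<le> \<phi> (drop_along v x)}"
proof -
  let ?W = "{w. v \<bullet> w = 0}"
  obtain g h where g: "convex_on ?W g" and h: "convex_on ?W h" and gh: "\<And>w. w \<in> ?W \<Longrightarrow> \<phi> w = g w - h w"
    using DC by (auto simp: DC_on_def)
  define f where "f x = max 0 (v \<bullet> x - \<phi> (drop_along v x))" for x
  have W: "drop_along v x \<in> ?W" for x by (simp add: inner_drop_along[OF v])
  have convg: "convex_on UNIV (\<lambda>x. g (drop_along v x))" and convh: "convex_on UNIV (\<lambda>x. h (drop_along v x))"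
    using convex_on_compose_affine[OF g linear_drop_along[of v], of 0]
      convex_on_compose_affine[OF h linear_drop_along[of v], of 0] W by auto
  have "convex_on UNIV (\<lambda>x. v \<bullet> x)" by (rule convex_onI) (auto simp: inner_add_right)
  then have "convex_on UNIV (\<lambda>x. v \<bullet> x + h (drop_along v x))" using convh by (rule convex_on_add)
  from convex_on_max[OF this convg]
  have "convex_on UNIV (\<lambda>x. max (v \<bullet> x + h (drop_along v x)) (g (drop_along v x)))" .
  moreover have "f x = max (v \<bullet> x + h (drop_along v x)) (g (drop_along v x)) - g (drop_along v x)" for x
    by (simp add: f_def gh[OF W] max_def)
  ultimately have f_DC: "DC_on UNIV f" unfolding DC_on_def using convg by blast
  have "1 \<le> norm u" if fx: "f x > 0" and u: "u \<in> clarke_subdiff f x" for x u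
  proof -
    let ?F = "nhds x \<times>\<^sub>F at_right (0::real)"
    have "open {z. 0 < f z}"
      by (rule open_Collect_less[OF continuous_on_const DC_on_UNIV_continuous[OF f_DC]])
    then have ev: "\<forall>\<^sub>F z in nhds x. f z > 0" using fx eventually_nhds_in_open by fastforce
    have lim1: "filterlim fst (nhds x) ?F" by (rule filterlim_fst)
    have "filterlim (\<lambda>p. fst ((\<lambda>(z, t). (z + (1 * t) *\<^sub>R (- v), 1 * t)) p)) (nhds x) ?F"
      by (rule filterlim_compose[OF filterlim_fst filterlim_clarke_shift]) simp
    then have lim2: "filterlim (\<lambda>p. fst p + snd p *\<^sub>R (- v)) (nhds x) ?F"
      by (simp add: case_prod_unfold)
    \<comment> \<open>Both end points of the increment lie where \<open>f\<close> is positive, so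
      the truncation at 0 is inactive and \<open>f\<close> drops by exactly
      \<open>t\<close>.\<close>
    have "\<forall>\<^sub>F p in ?F. f (fst p) > 0" using ev lim1 by (auto simp: filterlim_iff)
    moreover have "\<forall>\<^sub>F p in ?F. f (fst p + snd p *\<^sub>R (- v)) > 0" using ev lim2 by (auto simp: filterlim_iff)
    moreover have "\<forall>\<^sub>F p in ?F. snd p > 0"
      using filterlim_snd[of "at_right (0::real)" "nhds x"] by (auto simp: filterlim_at elim: eventually_mono)
    ultimately have "\<forall>\<^sub>F p in ?F. (\<lambda>(y, t). ereal ((f (y + t *\<^sub>R (- v)) - f y) / t)) p \<le> ereal (- 1)"
    proof eventually_elim
      case (elim p)
      obtain z t where p: "p = (z, t)" by (cases p)
      have "f (z + t *\<^sub>R (- v)) - f z = - t"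
        using elim drop_along_shift[OF v, of z "- t"] v
        by (auto simp: p f_def max_def inner_diff_right dot_square_norm split: if_splits)
      then show ?case using elim by (simp add: p)
    qed
    then have "clarke_dir f x (- v) \<le> ereal (- 1)" unfolding clarke_dir_def by (rule Limsup_bounded)
    moreover have "ereal (u \<bullet> (- v)) \<le> clarke_dir f x (- v)" using u unfolding clarke_subdiff_def by blast
    ultimately have "ereal (u \<bullet> (- v)) \<le> ereal (- 1)" by (rule order_trans[rotated])
    then have "1 \<le> u \<bullet> v" by simp
    also have "\<dots> \<le> norm u * norm v" by (rule norm_cauchy_schwarz)
    finally show ?thesis using v by simp
  qed
  then have "weakly_regular_value f 0" by (intro weakly_regular_valueI_bound[of 1]) auto
  moreover have "{x. v \<bullet> x \<le> \<phi> (drop_along v x)} = f -` {0}" by (auto simp: f_def max_def split: if_splits)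
  moreover have "\<forall>x. f x \<ge> 0" by (simp add: f_def)
  ultimately show ?thesis unfolding WDC_set_def using f_DC by blast
qed

text \<open>Serves the interior points of a domain; the zero function is never positive, so weak
  regularity is vacuous.\<close>

lemma WDC_set_UNIV: "WDC_set (UNIV :: 'a::euclidean_space set)"
proof -
  have "DC_on UNIV (\<lambda>x::'a. 0::real)"
    using convex_on_const[of "UNIV :: 'a set" 0] by (auto simp: DC_on_def)
  moreover have "weakly_regular_value (\<lambda>x::'a. 0::real) 0" by (simp add: weakly_regular_value_def)
  moreover have "(UNIV :: 'a set) = (\<lambda>x. 0::real) -` {0}" by auto
  ultimately show ?thesis unfolding WDC_set_def by blast
qed

lemma closed_DC_domain_imp_locally_WDC:
  fixes A :: "'a::euclidean_space set"
  assumes "closed_DC_domain A"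
  shows "locally_WDC A"
  unfolding locally_WDC_def
proof
  fix a assume a: "a \<in> A"
  show "\<exists>B U. WDC_set B \<and> open U \<and> a \<in> U \<and> A \<inter> U = B \<inter> U"
  proof (cases "a \<in> frontier A")
    case True
    obtain r v \<phi> where r: "r > 0" and v: "norm v = 1" and DC: "DC_on {w. v \<bullet> w = 0} \<phi>"
      and A: "\<And>x. x \<in> ball a r \<Longrightarrow> x \<in> A \<longleftrightarrow> v \<bullet> x \<le> \<phi> (drop_along v x)"
      by (rule closed_graph_domainE[OF assms[unfolded closed_DC_domain_def] True]) (rule that)
    have "A \<inter> ball a r = {x. v \<bullet> x \<le> \<phi> (drop_along v x)} \<inter> ball a r" using A by auto
    moreover have "a \<in> ball a r" using r by simp
    ultimately show ?thesis using DC_subgraph_WDC[OF v DC] open_ball by blast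
  next
    case False
    then have "a \<in> interior A" using a closure_subset by (auto simp: frontier_def)
    moreover have "A \<inter> interior A = UNIV \<inter> interior A" using interior_subset by blast
    ultimately show ?thesis using WDC_set_UNIV open_interior by blast
  qed
qed

section \<open>Locally WDC Lipschitz domains are DC\<close>

text \<open>For \<open>x = w + s *\<^sub>R v\<close> with \<open>w\<close> orthogonal to \<open>v\<close>, the signed height \<open>\<theta> x = \<phi> w - s\<close> of the
  graph above \<open>x\<close> lets everything be stated on the whole space instead of on a hyperplane.\<close>

lemma WDC_lipschitz_subgraph_height_DC:
  fixes v a :: "'a::euclidean_space" and \<theta> :: "'a \<Rightarrow> real"
  assumes v: "norm v = 1" and B: "WDC_set B"
    and lip: "K-lipschitz_on UNIV \<theta>" and shift: "\<And>x t. \<theta> (x + t *\<^sub>R v) = \<theta> x - t"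
    and a: "\<theta> a = 0" and R: "R > 0" and local: "\<And>x. x \<in> ball a R \<Longrightarrow> x \<in> B \<longleftrightarrow> \<theta> x \<ge> 0"
  obtains \<rho> \<psi> where "\<rho> > 0" "DC_on UNIV \<psi>" "\<And>x. x \<in> ball a \<rho> \<Longrightarrow> \<psi> x = \<theta> x"
proof -
  obtain f where DC: "DC_on UNIV f" and f0: "\<And>x. f x \<ge> 0" and Bf: "B = f -` {0}"
    and reg: "weakly_regular_value f 0"
    using B unfolding WDC_set_def by blast
  obtain g h where g: "convex_on UNIV g" and h: "convex_on UNIV h" and gh: "\<And>x. f x = g x - h x"
    using DC by (auto simp: DC_on_def)
  have K: "K \<ge> 0" using lip lipschitz_on_nonneg by blast
  have fa: "f a = 0" using local[of a] a R Bf by simp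
  obtain \<epsilon> \<rho>1 where \<epsilon>: "\<epsilon> > 0" "\<rho>1 > 0"
    "\<And>x u. \<lbrakk>x \<in> ball a \<rho>1; f x > 0; u \<in> clarke_subdiff f x\<rbrakk> \<Longrightarrow> \<epsilon> \<le> norm u"
    using weakly_regular_value_locally_uniform[OF reg fa] by metis
  define r where "r = min R \<rho>1"
  have r: "r > 0" using R \<epsilon> by (simp add: r_def)
  \<comment> \<open>Then graph points over the ball lie within \<open>r / 4\<close> of
    \<open>a\<close>, points up to \<open>r / 4\<close> further along \<open>v\<close> within
    \<open>r / 2\<close>, and the small balls around those still inside radius
    \<open>r\<close>.\<close>
  define \<rho> where "\<rho> = r / (4 * (1 + K))"
  have \<rho>: "\<rho> > 0" "(1 + K) * \<rho> = r / 4" using r K by (auto simp: \<rho>_def add_nonneg_eq_0_iff field_simps)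
  \<comment> \<open>Chosen so that \<open>c * t\<close> is the error bound
    \<open>\<epsilon> / 2 * \<delta>\<close> obtained below.\<close>
  define c where "c = \<epsilon> / 2 / (2 * (1 + K))"
  have c: "c > 0" using \<epsilon> K by (simp add: c_def)
  have near: "dist a (x + \<theta> x *\<^sub>R v) < r / 4" if "x \<in> ball a \<rho>" for x
  proof -
    have "\<bar>\<theta> x\<bar> \<le> K * dist x a" using lipschitz_onD[OF lip, of x a] a by (simp add: dist_real_def)
    then have "dist x (x + \<theta> x *\<^sub>R v) \<le> K * dist x a" using v by (simp add: dist_norm)
    then have "dist a (x + \<theta> x *\<^sub>R v) \<le> (1 + K) * dist a x"
      using dist_triangle[of a "x + \<theta> x *\<^sub>R v" x] by (simp add: dist_commute algebra_simps)
    also have "\<dots> < (1 + K) * \<rho>" using that K by (intro mult_strict_left_mono) auto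
    finally show ?thesis using \<rho> by simp
  qed
  obtain \<psi> where \<psi>: "DC_on UNIV \<psi>" "\<And>x. x \<in> ball a \<rho> \<Longrightarrow> \<psi> x = \<theta> x"
  proof (rule DC_implicit_function[OF g h lipschitz_on_subset[OF lip subset_UNIV] c, of "r / 4" a \<rho> v])
    show "r / 4 > 0" using r by simp
    fix x assume x: "x \<in> ball a \<rho>"
    have "x + \<theta> x *\<^sub>R v \<in> B" using local[of "x + \<theta> x *\<^sub>R v"] near[OF x] r by (simp add: r_def shift)
    then show "g (x + \<theta> x *\<^sub>R v) = h (x + \<theta> x *\<^sub>R v)" using gh[of "x + \<theta> x *\<^sub>R v"] by (simp add: Bf)
    fix t assume t: "0 \<le> t" "t \<le> r / 4"
    define y where "y = x + (\<theta> x + t) *\<^sub>R v"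
    have "dist a y \<le> dist a (x + \<theta> x *\<^sub>R v) + dist (x + \<theta> x *\<^sub>R v) y" by (rule dist_triangle)
    moreover have "dist (x + \<theta> x *\<^sub>R v) y = t" using t v by (simp add: y_def dist_norm algebra_simps)
    ultimately have ay: "dist a y < r / 2" using near[OF x] t by simp
    have \<theta>y: "\<theta> y = - t" by (simp add: y_def shift)
    \<comment> \<open>Since \<open>\<theta> y = - t\<close> and \<open>\<theta>\<close> is
      \<open>K\<close>-Lipschitz, \<open>\<theta>\<close> is at most \<open>- t / 2\<close> on the
      ball of radius \<open>\<delta>\<close> around \<open>y\<close>. For \<open>t > 0\<close> this
      ball therefore misses \<open>B\<close>.\<close>
    define \<delta> where "\<delta> = t / (2 * (1 + K))"
    have \<delta>: "0 \<le> \<delta>" "\<delta> \<le> t / 2" "K * \<delta> \<le> t / 2"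
    proof -
      show "0 \<le> \<delta>" using t K by (simp add: \<delta>_def)
      have "(1 + K) * \<delta> = t / 2" using K by (simp add: \<delta>_def add_nonneg_eq_0_iff field_simps)
      then have "\<delta> + K * \<delta> = t / 2" by (simp add: algebra_simps)
      moreover have "K * \<delta> \<ge> 0" using K \<open>0 \<le> \<delta>\<close> by simp
      ultimately show "\<delta> \<le> t / 2" "K * \<delta> \<le> t / 2" using \<open>0 \<le> \<delta>\<close> by linarith+
    qed
    have "f y \<ge> \<epsilon> / 2 * \<delta>"
    proof (cases "t = 0")
      \<comment> \<open>Here \<open>y\<close> lies on the graph and \<open>f\<close> is not positive
        at it; nonnegativity of \<open>f\<close> is enough.\<close>
      case True
      then show ?thesis using f0 by (simp add: \<delta>_def)
    next
      case False
      have az: "z \<in> ball a r" if "z \<in> cball y \<delta>" for z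
        using dist_triangle[of a z y] that ay \<delta> t by auto
      have fz: "f z > 0" if z: "z \<in> cball y \<delta>" for z
      proof -
        have "\<bar>\<theta> z - \<theta> y\<bar> \<le> K * dist z y" using lipschitz_onD[OF lip, of z y] by (simp add: dist_real_def)
        also have "\<dots> \<le> K * \<delta>" using z K by (intro mult_left_mono) (auto simp: dist_commute)
        finally have "\<theta> z < 0" using \<theta>y \<delta> False t by linarith
        then have "z \<notin> B" using local[of z] az[OF z] by (simp add: r_def)
        then show ?thesis using f0[of z] by (simp add: Bf)
      qed
      show ?thesis
      proof (rule clarke_error_bound[OF DC_on_UNIV_continuous[OF DC], where \<epsilon> = \<epsilon>])
        show "\<epsilon> \<le> norm u" if "z \<in> cball y \<delta>" "u \<in> clarke_subdiff f z" for z u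
          by (rule \<epsilon>(3)[OF _ fz[OF that(1)] that(2)]) (use az[OF that(1)] in \<open>simp add: r_def\<close>)
      qed (use \<epsilon> \<delta> fz in auto)
    qed
    then show "c * t \<le> g (x + (\<theta> x + t) *\<^sub>R v) - h (x + (\<theta> x + t) *\<^sub>R v)"
      using gh[of y] by (simp add: c_def \<delta>_def y_def)
  qed auto
  then show ?thesis using \<rho>(1) that by blast
qed

text \<open>The height \<open>\<theta>\<close> agrees near \<open>a\<close> with a DC function
  \<open>\<psi>\<close> on the whole space. Restricting \<open>\<psi>\<close> to the translate of
  the hyperplane through \<open>a\<close> gives the DC function that replaces
  \<open>\<phi>\<close>.\<close>

lemma locally_WDC_imp_closed_DC_domain:
  fixes A :: "'a::euclidean_space set"
  assumes lip: "closed_lipschitz_domain A" and WDC: "locally_WDC A"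
  shows "closed_DC_domain A"
  unfolding closed_DC_domain_def
proof (rule closed_graph_domainI)
  show closed: "closed A" using lip by (simp add: closed_lipschitz_domain_def closed_graph_domain_def)
  fix a assume a: "a \<in> frontier A"
  obtain r v \<phi> where r: "r > 0" and v: "norm v = 1"
    and "\<exists>C. C-lipschitz_on {w. v \<bullet> w = 0} \<phi>"
    and A: "\<And>x. x \<in> ball a r \<Longrightarrow> x \<in> A \<longleftrightarrow> v \<bullet> x \<le> \<phi> (drop_along v x)"
    by (rule closed_graph_domainE[OF lip[unfolded closed_lipschitz_domain_def] a]) (rule that)
  define W where "W = {w. v \<bullet> w = 0}"
  obtain C where C: "C-lipschitz_on W \<phi>"
    using \<open>\<exists>C. C-lipschitz_on {w. v \<bullet> w = 0} \<phi>\<close> by (auto simp: W_def)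
  have inW: "drop_along v x \<in> W" for x by (simp add: W_def inner_drop_along[OF v])
  define \<theta> where "\<theta> x = \<phi> (drop_along v x) - v \<bullet> x" for x
  have A\<theta>: "x \<in> A \<longleftrightarrow> \<theta> x \<ge> 0" if "x \<in> ball a r" for x
    using A[OF that] by (simp add: \<theta>_def)
  have shift: "\<theta> (x + t *\<^sub>R v) = \<theta> x - t" for x t
    using v by (simp add: \<theta>_def drop_along_shift inner_add_right dot_square_norm)
  have lip\<theta>: "(C + 1)-lipschitz_on UNIV \<theta>"
  proof (rule lipschitz_onI)
    have "C \<ge> 0" using C lipschitz_on_nonneg by blast
    then show "0 \<le> C + 1" by simp
    fix x y
    have "\<bar>\<phi> (drop_along v x) - \<phi> (drop_along v y)\<bar> \<le> C * dist (drop_along v x) (drop_along v y)"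
      using lipschitz_onD[OF C inW inW] by (simp add: dist_real_def)
    also have "\<dots> \<le> C * dist x y" by (intro mult_left_mono dist_drop_along_le v \<open>C \<ge> 0\<close>)
    finally have "\<bar>\<phi> (drop_along v x) - \<phi> (drop_along v y)\<bar> \<le> C * dist x y" .
    moreover have "\<bar>v \<bullet> (x - y)\<bar> \<le> dist x y"
      using Cauchy_Schwarz_ineq2[of v "x - y"] v by (simp add: dist_norm)
    ultimately show "dist (\<theta> x) (\<theta> y) \<le> (C + 1) * dist x y"
      by (simp add: \<theta>_def dist_real_def inner_diff_right algebra_simps)
  qed
  have "a \<in> A" using a closed frontier_subset_closed by blast
  have \<theta>a: "\<theta> a = 0"
  proof (rule ccontr)
    \<comment> \<open>A positive height would persist near \<open>a\<close> and make
      \<open>a\<close> an interior point.\<close>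
    assume "\<theta> a \<noteq> 0"
    then have "\<theta> a > 0" using A\<theta>[of a] \<open>a \<in> A\<close> r by simp
    have "open {x. 0 < \<theta> x}"
      by (rule open_Collect_less[OF continuous_on_const lipschitz_on_continuous_on[OF lip\<theta>]])
    then have "open ({x. 0 < \<theta> x} \<inter> ball a r)" by auto
    moreover have "{x. 0 < \<theta> x} \<inter> ball a r \<subseteq> A" using A\<theta> by auto
    ultimately have "a \<in> interior A" using \<open>\<theta> a > 0\<close> r by (intro interiorI) auto
    then show False using a by (simp add: frontier_def)
  qed
  obtain B U where B: "WDC_set B" and U: "open U" "a \<in> U" and AU: "A \<inter> U = B \<inter> U"
    using WDC \<open>a \<in> A\<close> unfolding locally_WDC_def by blast
  obtain R0 where R0: "R0 > 0" "ball a R0 \<subseteq> U" using U open_contains_ball by blast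
  have local: "x \<in> B \<longleftrightarrow> \<theta> x \<ge> 0" if "x \<in> ball a (min r R0)" for x
    using A\<theta>[of x] AU R0 that by auto
  obtain \<rho> \<psi> where \<rho>: "\<rho> > 0" and \<psi>: "DC_on UNIV \<psi>" "\<And>x. x \<in> ball a \<rho> \<Longrightarrow> \<psi> x = \<theta> x"
    using WDC_lipschitz_subgraph_height_DC[OF v B lip\<theta> shift \<theta>a _ local] r R0 by (metis min_less_iff_conj)
  define b where "b = (v \<bullet> a) *\<^sub>R v"
  \<comment> \<open>For \<open>w\<close> in the hyperplane
    \<open>\<theta> (w + b) = \<phi> w - v \<bullet> a\<close>; the shift by \<open>b\<close> moves
    the argument into the region near \<open>a\<close> where \<open>\<psi>\<close> equals
    \<open>\<theta>\<close>.\<close>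
  define \<phi>' where "\<phi>' w = \<psi> (w + b) + v \<bullet> a" for w
  obtain g h where g: "convex_on UNIV g" and h: "convex_on UNIV h" and gh: "\<And>x. \<psi> x = g x - h x"
    using \<psi>(1) by (auto simp: DC_on_def)
  have "convex_on UNIV (\<lambda>w. g (w + b) + v \<bullet> a)" "convex_on UNIV (\<lambda>w. h (w + b))"
    using convex_on_compose_affine[OF g linear_ident, of b] convex_on_compose_affine[OF h linear_ident, of b]
    by (auto intro!: convex_on_add simp: convex_on_const)
  then have "convex_on W (\<lambda>w. g (w + b) + v \<bullet> a)" "convex_on W (\<lambda>w. h (w + b))"
    using convex_on_subset[OF _ subset_UNIV subspace_imp_convex[OF subspace_hyperplane]]
    unfolding W_def by blast+
  moreover have "\<phi>' w = (g (w + b) + v \<bullet> a) - h (w + b)" for w by (simp add: \<phi>'_def gh)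
  ultimately have DC: "DC_on W \<phi>'" unfolding DC_on_def by blast
  have eq: "\<phi>' (drop_along v x) = \<phi> (drop_along v x)" if "x \<in> ball a \<rho>" for x
  proof -
    \<comment> \<open>Since \<open>a\<close> is its own projection plus \<open>b\<close>, projecting
      and shifting by \<open>b\<close> does not increase the distance to \<open>a\<close>.\<close>
    have "dist (drop_along v x + b) a = dist (drop_along v x + b) (drop_along v a + b)"
      by (simp add: b_def drop_along_add)
    also have "\<dots> \<le> dist x a" by (simp add: dist_drop_along_le[OF v])
    finally have "drop_along v x + b \<in> ball a \<rho>" using that by (simp add: dist_commute)
    then have "\<phi>' (drop_along v x) = \<theta> (drop_along v x + b) + v \<bullet> a" by (simp add: \<phi>'_def \<psi>(2))
    also have "\<dots> = \<phi> (drop_along v x)"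
      using inner_drop_along[OF v] by (simp add: b_def shift) (simp add: \<theta>_def drop_along_orthogonal)
    finally show ?thesis .
  qed
  have "\<forall>x\<in>ball a (min r \<rho>). x \<in> A \<longleftrightarrow> v \<bullet> x \<le> \<phi>' (drop_along v x)"
    using A eq by simp
  then show "\<exists>r>0. \<exists>v \<phi>. norm v = 1 \<and> DC_on {w. v \<bullet> w = 0} \<phi> \<and>
      (\<forall>x\<in>ball a r. x \<in> A \<longleftrightarrow> v \<bullet> x \<le> \<phi> (drop_along v x))"
    using r \<rho> v DC unfolding W_def
    by (intro exI[of _ "min r \<rho>"] conjI exI[of _ v] exI[of _ \<phi>']) simp_all
qed

theorem theorem6p10:
  fixes A :: "'a::euclidean_space set"
  assumes "closed_lipschitz_domain A"
  shows "locally_WDC A \<longleftrightarrow> closed_DC_domain A"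
  using assms locally_WDC_imp_closed_DC_domain closed_DC_domain_imp_locally_WDC by blast

end
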